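(* Let $s,t\ge0$ and $0<\theta<\mu$. Let $Z^{(\theta)}_{m,n}$ be the partition function of the stationary log-gamma model with parameters $(\mu,\theta)$. Then for $\xi\ge0$ the limit $$\Lambda_{\theta,(s,t)}(\xi)=\lim_{n\to\infty}n^{-1}\log\mathbb E\,e^{\xi\log Z^{(\theta)}_{\lfloor ns\rfloor,\lfloor nt\rfloor}}$$ exists and is given by $$\Lambda_{\theta,(s,t)}(\xi)=\begin{cases}\max\big\{s\,M_\theta(\xi)-t\,M_{\mu-\theta}(-\xi),\ t\,M_{\mu-\theta}(\xi)-s\,M_\theta(-\xi)\big\}, & 0\le\xi<\theta\wedge(\mu-\theta),\\[2pt] \infty, & \xi\ge\theta\wedge(\mu-\theta).\end{cases}$$
   Context: $\mathrm{Gamma}(\nu)$ is the distribution on $(0,\infty)$ with density $\Gamma(\nu)^{-1}x^{\nu-1}e^{-x}$. For $\nu>0$, $M_\nu(\xi)=\log\Gamma(\nu-\xi)-\log\Gamma(\nu)$ for $\xi<\nu$ and $M_\nu(\xi)=\infty$ for $\xi\ge\nu$. $a\wedge b=\min(a,b)$. Stationary log-gamma model with parameters $(\mu,\theta)$, $0<\theta<\mu<\infty$: let $\{U_{i,0},V_{0,j},Y_{i,j}: i,j\in\mathbb N\}$ ($\mathbb N=\{1,2,\dots\}$) be independent with $U_{i,0}^{-1}\sim\mathrm{Gamma}(\theta)$, $V_{0,j}^{-1}\sim\mathrm{Gamma}(\mu-\theta)$, $Y_{i,j}^{-1}\sim\mathrm{Gamma}(\mu)$. Extend the weights to all of $\mathbb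 Z_+^2$ by $Y_{0,0}=1$, $Y_{i,0}=U_{i,0}$, $Y_{0,j}=V_{0,j}$ for $i,j\in\mathbb N$. Then $Z^{(\theta)}_{m,n}=\sum_{x_\cdot}\prod_{j=1}^{m+n}Y_{x_j}$, where the sum is over all directed paths $x_0=(0,0),x_1,\dots,x_{m+n}=(m,n)$ in $\mathbb Z_+^2$ with steps $x_{k+1}-x_k\in\{(1,0),(0,1)\}$.
   Formalization: When s=0 or t=0 and ξ ≥ θ∧(μ−θ), the value ∞ is replaced by the max-expression of the first line with 0·∞=0, since ∞ is false there in general (for s=t=0 the limit is 0; for s=0<t and θ≤ξ<μ−θ it is t M_{μ−θ}(ξ)). *)

theory Defs
  imports "HOL-Probability.Probability"
begin

definition gamma_density :: "real \<Rightarrow> real \<Rightarrow> real" where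
  "gamma_density \<nu> x = (if 0 < x then x powr (\<nu> - 1) * exp (- x) / Gamma \<nu> else 0)"

text \<open>Logarithmic moment generating function of the logarithm of an inverse Gamma variable.
  With the \<open>ereal\<close> convention \<open>0 * \<infinity> = 0\<close>, a term with coefficient zero vanishes
  also where \<open>M_fun\<close> is infinite; this matters for directions along a coordinate axis.\<close>

definition M_fun :: "real \<Rightarrow> real \<Rightarrow> ereal" where
  "M_fun \<nu> \<xi> = (if \<xi> < \<nu> then ereal (ln (Gamma (\<nu> - \<xi>)) - ln (Gamma \<nu>)) else \<infinity>)"

text \<open>Logarithm on \<open>[0, \<infinity>]\<close>, needed because the moments in question may be infinite.\<close>

definition ln_ennreal :: "ennreal \<Rightarrow> ereal" where
  "ln_ennreal x =
    (if x = \<top> then \<infinity> else if x = 0 then -\<infinity> else ereal (ln (enn2real x)))"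

text \<open>The weights on all of \<open>\<int>\<^sub>+\<^sup>2\<close>. The values \<open>U 0\<close>, \<open>V 0\<close>, \<open>Y (0, j)\<close> and \<open>Y (i, 0)\<close>
  of the given families are never used.\<close>

fun ext_weight ::
  "(nat \<Rightarrow> 'a \<Rightarrow> real) \<Rightarrow> (nat \<Rightarrow> 'a \<Rightarrow> real) \<Rightarrow> (nat \<times> nat \<Rightarrow> 'a \<Rightarrow> real) \<Rightarrow> nat \<times> nat \<Rightarrow> 'a \<Rightarrow> real"
where
  "ext_weight U V Y (0, 0) = (\<lambda>_. 1)"
| "ext_weight U V Y (Suc i, 0) = U (Suc i)"
| "ext_weight U V Y (0, Suc j) = V (Suc j)"
| "ext_weight U V Y (Suc i, Suc j) = Y (Suc i, Suc j)"

text \<open>Independence of the extended weights off the origin is joint independence of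
  \<open>U i\<close>, \<open>V j\<close>, \<open>Y (i, j)\<close> for \<open>i, j \<ge> 1\<close>.\<close>

locale stationary_log_gamma = prob_space M
  for M :: "'a measure" +
  fixes \<mu> \<theta> :: real
    and U V :: "nat \<Rightarrow> 'a \<Rightarrow> real"
    and Y :: "nat \<times> nat \<Rightarrow> 'a \<Rightarrow> real"
  assumes theta_pos: "0 < \<theta>"
    and theta_less: "\<theta> < \<mu>"
    and indep: "indep_vars (\<lambda>_. borel) (ext_weight U V Y) (UNIV - {(0, 0)})"
    and dist_U: "\<And>i. 1 \<le> i \<Longrightarrow> distributed M lborel (\<lambda>\<omega>. inverse (U i \<omega>)) (gamma_density \<theta>)"
    and dist_V: "\<And>j. 1 \<le> j \<Longrightarrow> distributed M lborel (\<lambda>\<omega>. inverse (V j \<omega>)) (gamma_density (\<mu> - \<theta>))"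
    and dist_Y: "\<And>i j. 1 \<le> i \<Longrightarrow> 1 \<le> j \<Longrightarrow>
      distributed M lborel (\<lambda>\<omega>. inverse (Y (i, j) \<omega>)) (gamma_density \<mu>)"

definition directed_paths :: "nat \<Rightarrow> nat \<Rightarrow> (nat \<times> nat) list set" where
  "directed_paths m n = {x. length x = Suc (m + n) \<and> x ! 0 = (0, 0) \<and> x ! (m + n) = (m, n) \<and>
     (\<forall>k < m + n. x ! Suc k = x ! k + (1, 0) \<or> x ! Suc k = x ! k + (0, 1))}"

lemma finite_directed_paths: "finite (directed_paths m n)"
proof (rule finite_subset)
  show "directed_paths m n \<subseteq>
    {x. set x \<subseteq> {..m + n} \<times> {..m + n} \<and> length x = Suc (m + n)}"
  proof
    fix x assume x: "x \<in> directed_paths m n"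
    have b: "k \<le> m + n \<Longrightarrow> fst (x ! k) \<le> k \<and> snd (x ! k) \<le> k" for k
    proof (induction k)
      case 0
      then show ?case using x by (simp add: directed_paths_def)
    next
      case (Suc k)
      then have "x ! Suc k = x ! k + (1, 0) \<or> x ! Suc k = x ! k + (0, 1)"
        using x by (simp add: directed_paths_def)
      with Suc show ?case by auto
    qed
    have len: "length x = Suc (m + n)" using x by (simp add: directed_paths_def)
    have "p \<in> {..m + n} \<times> {..m + n}" if p: "p \<in> set x" for p
    proof -
      obtain k where k: "k \<le> m + n" "p = x ! k"
        using p len by (auto simp: in_set_conv_nth less_Suc_eq_le)
      then show ?thesis using b[OF k(1)] by (auto simp: mem_Times_iff)
    qed
    then show "x \<in> {x. set x \<subseteq> {..m + n} \<times> {..m + n} \<and> length x = Suc (m + n)}"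
      using len by blast
  qed
  show "finite {x. set x \<subseteq> {..m + n} \<times> {..m + n} \<and> length x = Suc (m + n)}"
    by (rule finite_lists_length_eq) simp
qed

definition Z_stat ::
  "(nat \<Rightarrow> 'a \<Rightarrow> real) \<Rightarrow> (nat \<Rightarrow> 'a \<Rightarrow> real) \<Rightarrow> (nat \<times> nat \<Rightarrow> 'a \<Rightarrow> real) \<Rightarrow> nat \<Rightarrow> nat \<Rightarrow> 'a \<Rightarrow> real"
where
  "Z_stat U V Y m n \<omega> =
    (\<Sum>x\<in>directed_paths m n. \<Prod>j=1..m + n. ext_weight U V Y (x ! j) \<omega>)"

end

theory Submission
  imports Defs
begin

text \<open>Write \<open>u = E U\<^sup>\<xi>\<close>, \<open>u' = E U\<^bsup>-\<xi>\<^esup>\<close> and likewise \<open>v, v'\<close>. By the Burke property the horizontal ratios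
  along row \<open>n\<close> are again i.i.d., so \<open>E (Z\<^bsub>m,n\<^esub> / Z\<^bsub>0,n\<^esub>)\<^sup>\<xi> = u\<^sup>m\<close>, where \<open>Z\<^bsub>0,n\<^esub>\<close> is the product of the \<open>V\<^bsub>0,j\<^esub>\<close>.
  The paths that start with a horizontal step contribute a part of \<open>Z\<^bsub>m,n\<^esub>\<close> that is independent of the
  \<open>V\<^bsub>0,j\<^esub>\<close>, so its \<open>\<xi>\<close>-th moment is at most \<open>u\<^sup>m / v'\<^sup>n\<close>; with the transposed estimate this gives the upper
  bound. For the lower bound \<open>Z\<^bsub>m,n\<^esub>\<close> is split according to the height \<open>l\<close> at which the path leaves the
  vertical axis. With \<open>W\<^sub>l\<close> the contribution of the
  weights off that axis, the height \<open>l\<close> contributes \<open>E W\<^sub>l\<^sup>\<xi> v'\<^bsup>n-l\<^esup> \<le> (E W\<^sub>l\<^sup>\<xi> v\<^sup>l) v'\<^sup>n \<le> E Z\<^bsub>m,n\<^esub>\<^sup>\<xi> v'\<^sup>n\<close> to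
  \<open>E (Z\<^bsub>m,n\<^esub> / Z\<^bsub>0,n\<^esub>)\<^sup>\<xi>\<close> because \<open>1 \<le> v v'\<close>, so \<open>u\<^sup>m \<le> (n + 1)\<^bsup>\<xi>+1\<^esup> v'\<^sup>n E Z\<^bsub>m,n\<^esub>\<^sup>\<xi>\<close>. The bounds differ by a
  factor that is polynomial in \<open>m + n\<close>.\<close>

section \<open>Beta-gamma algebra\<close>

definition gamma_law :: "real \<Rightarrow> real measure" where
  "gamma_law \<nu> = density lborel (\<lambda>x. ennreal (gamma_density \<nu> x))"

lemma sets_gamma_law [simp, measurable_cong]: "sets (gamma_law \<nu>) = sets borel"
  by (simp add: gamma_law_def)

lemma space_gamma_law [simp]: "space (gamma_law \<nu>) = UNIV"
  by (simp add: gamma_law_def)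

lemma measurable_gamma_density [measurable]: "gamma_density \<nu> \<in> borel_measurable borel"
  unfolding gamma_density_def by measurable

lemma nn_integral_gamma_law:
  "f \<in> borel_measurable borel \<Longrightarrow>
    (\<integral>\<^sup>+x. f x \<partial>gamma_law \<nu>) = (\<integral>\<^sup>+x. ennreal (gamma_density \<nu> x) * f x \<partial>lborel)"
  unfolding gamma_law_def by (subst nn_integral_density) auto

text \<open>Euler's integral for \<open>Gamma\<close> after rescaling the variable by
  \<open>c\<close>. The rate is kept general because the beta-gamma identity needs the rate
  \<open>1 + r\<close>.\<close>

lemma nn_integral_powr_exp:
  fixes \<nu> c :: real
  assumes "0 < \<nu>" "0 < c"
  shows "(\<integral>\<^sup>+x. ennreal (if 0 < x then x powr (\<nu> - 1) * exp (- (c * x)) else 0) \<partial>lborel)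
    = ennreal (Gamma \<nu> * c powr - \<nu>)"
proof -
  let ?g = "\<lambda>x::real. ennreal (if 0 < x then x powr (\<nu> - 1) * exp (- x) else 0)"
  have "ennreal (Gamma \<nu>) = (\<integral>\<^sup>+x. ?g x \<partial>lborel)"
    unfolding Gamma_conv_nn_integral_real[OF assms(1)]
    by (rule nn_integral_cong) (auto simp: exp_minus divide_inverse indicator_def)
  also have "\<dots> = ennreal c * (\<integral>\<^sup>+x. ?g (0 + c * x) \<partial>lborel)"
    using assms(2) by (subst nn_integral_real_affine[where c = c and t = 0]) auto
  also have "(\<integral>\<^sup>+x. ?g (0 + c * x) \<partial>lborel) = (\<integral>\<^sup>+x. ennreal (c powr (\<nu> - 1)) *
      ennreal (if 0 < x then x powr (\<nu> - 1) * exp (- (c * x)) else 0) \<partial>lborel)"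
    using assms(2)
    by (intro nn_integral_cong)
      (auto simp: zero_less_mult_iff powr_mult mult.assoc simp flip: ennreal_mult')
  also have "\<dots> = ennreal (c powr (\<nu> - 1)) *
      (\<integral>\<^sup>+x. ennreal (if 0 < x then x powr (\<nu> - 1) * exp (- (c * x)) else 0) \<partial>lborel)"
    by (rule nn_integral_cmult) measurable
  finally have *: "ennreal (Gamma \<nu>) = ennreal (c powr \<nu>) *
      (\<integral>\<^sup>+x. ennreal (if 0 < x then x powr (\<nu> - 1) * exp (- (c * x)) else 0) \<partial>lborel)" (is "_ = _ * ?I")
    using assms(2) by (simp add: mult.assoc[symmetric] powr_mult_base flip: ennreal_mult')
  have "ennreal (c powr - \<nu>) * ennreal (Gamma \<nu>) = ennreal (c powr - \<nu> * c powr \<nu>) * ?I"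
    unfolding * by (simp add: mult.assoc[symmetric] ennreal_mult')
  then show ?thesis
    using assms by (simp add: powr_minus ennreal_mult' [symmetric] mult.commute)
qed

text \<open>A power tilts the Gamma density into one of shape \<open>\<nu> - \<xi>\<close>, up to
  normalisation. The factor 1 in the exponent matches \<open>nn_integral_powr_exp\<close> at rate
  1.\<close>

lemma gamma_density_powr:
  "gamma_density \<nu> x * x powr - \<xi> = (if 0 < x then x powr (\<nu> - \<xi> - 1) * exp (- (1 * x)) else 0) / Gamma \<nu>"
proof (cases "0 < x")
  case True
  have "x powr (\<nu> - 1) * x powr - \<xi> = x powr (\<nu> - \<xi> - 1)"
    by (simp flip: powr_add) (simp add: algebra_simps)
  with True show ?thesis by (simp add: gamma_density_def mult_ac)
qed (simp add: gamma_density_def)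

text \<open>The exponent is negative because the weights are reciprocals of Gamma variables.\<close>

lemma gamma_law_moment:
  assumes "0 < \<nu>" "\<xi> < \<nu>"
  shows "(\<integral>\<^sup>+x. ennreal (x powr - \<xi>) \<partial>gamma_law \<nu>) = ennreal (Gamma (\<nu> - \<xi>) / Gamma \<nu>)"
proof -
  have G: "Gamma \<nu> > 0" using assms by simp
  have "(\<integral>\<^sup>+x. ennreal (x powr - \<xi>) \<partial>gamma_law \<nu>)
      = (\<integral>\<^sup>+x. ennreal (if 0 < x then x powr (\<nu> - \<xi> - 1) * exp (- (1 * x)) else 0) * ennreal (1 / Gamma \<nu>) \<partial>lborel)"
    using G by (subst nn_integral_gamma_law, measurable, intro nn_integral_cong)
      (simp add: gamma_density_powr flip: ennreal_mult'')
  also have "\<dots> = ennreal (Gamma (\<nu> - \<xi>)) * ennreal (1 / Gamma \<nu>)"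
    using nn_integral_powr_exp[of "\<nu> - \<xi>" 1] assms
    by (subst nn_integral_multc) auto
  also have "\<dots> = ennreal (Gamma (\<nu> - \<xi>) / Gamma \<nu>)"
    using G by (simp flip: ennreal_mult'')
  finally show ?thesis .
qed

lemma AE_gamma_law_pos: "AE x in gamma_law \<nu>. 0 < x"
  unfolding gamma_law_def by (subst AE_density) (auto simp: gamma_density_def)

lemma prob_space_gamma_law:
  assumes "0 < \<nu>"
  shows "prob_space (gamma_law \<nu>)"
proof (rule prob_spaceI)
  have G: "Gamma \<nu> > 0" using assms by simp
  \<comment> \<open>The total mass is the moment of order 0. As \<open>0 powr 0 = 0\<close>, the
    integrand is 1 only almost everywhere.\<close>
  have "(\<integral>\<^sup>+x. ennreal (x powr - 0) \<partial>gamma_law \<nu>) = (\<integral>\<^sup>+x. 1 \<partial>gamma_law \<nu>)"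
    using AE_gamma_law_pos[of \<nu>] by (intro nn_integral_cong_AE) (auto elim!: eventually_mono)
  then show "emeasure (gamma_law \<nu>) (space (gamma_law \<nu>)) = 1"
    using gamma_law_moment[of \<nu> 0] assms G by simp
qed

text \<open>The integral over \<open>{exp (- t)..1}\<close> equals \<open>t\<close> for every
  \<open>t \<ge> 0\<close>, which excludes a finite value.\<close>

lemma nn_integral_inverse_unit_interval:
  "(\<integral>\<^sup>+x. ennreal (if 0 < x \<and> x < 1 then 1 / x else 0) \<partial>lborel) = (\<infinity>::ennreal)" (is "?I = _")
proof -
  have *: "ennreal t \<le> ?I" if t: "0 \<le> t" for t
  proof -
    have "((\<lambda>x. 1 / x) has_integral (ln 1 - ln (exp (- t)))) {exp (- t)..1}"
      using t by (intro fundamental_theorem_of_calculus)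
        (auto intro!: derivative_eq_intros simp: has_real_derivative_iff_has_vector_derivative[symmetric]
          intro: less_le_trans[OF exp_gt_zero] dest: less_le_trans[OF exp_gt_zero])
    then have "((\<lambda>x. if x \<in> {exp (- t)..1} then 1 / x else 0) has_integral t) UNIV"
      by (subst has_integral_restrict_UNIV) simp
    also have "(\<lambda>x. if x \<in> {exp (- t)..1} then 1 / x else 0) = (\<lambda>x. 1 / x * indicator {exp (- t)..1} x)"
      by auto
    finally have "ennreal t = (\<integral>\<^sup>+x. ennreal (1 / x * indicator {exp (- t)..1} x) \<partial>lborel)"
      by (intro nn_integral_has_integral_lborel[symmetric])
        (auto simp: indicator_def dest: less_le_trans[OF exp_gt_zero] intro: less_imp_le)
    also have "\<dots> \<le> ?I"
    proof (rule nn_integral_mono_AE)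
      \<comment> \<open>The closed interval contains the endpoint 1 and the open one does
        not.\<close>
      have "AE x in lborel. x \<noteq> (1::real)" by (rule AE_lborel_singleton)
      then show "AE x in lborel. ennreal (1 / x * indicator {exp (- t)..1} x)
          \<le> ennreal (if 0 < x \<and> x < 1 then 1 / x else 0)"
        by eventually_elim (auto simp: indicator_def dest: less_le_trans[OF exp_gt_zero])
    qed
    finally show ?thesis .
  qed
  show ?thesis
  proof (rule ccontr)
    assume "?I \<noteq> \<infinity>"
    then obtain r where r: "?I = ennreal r" "0 \<le> r" by (cases ?I) auto
    with *[of "r + 1"] show False by simp
  qed
qed

text \<open>For \<open>\<xi> \<ge> \<nu>\<close> the exponent \<open>\<nu> - \<xi> - 1\<close> is at
  most -1. On the unit interval, where \<open>exp (- x) \<ge> exp (- 1)\<close>, the integrand thus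
  dominates a multiple of \<open>1 / x\<close>.\<close>

lemma gamma_law_moment_infinite:
  assumes "0 < \<nu>" "\<nu> \<le> \<xi>"
  shows "(\<integral>\<^sup>+x. ennreal (x powr - \<xi>) \<partial>gamma_law \<nu>) = \<infinity>"
proof -
  have G: "Gamma \<nu> > 0" using assms by simp
  let ?f = "\<lambda>x::real. ennreal (if 0 < x \<and> x < 1 then 1 / x else 0)"
  have "ennreal (exp (- 1) / Gamma \<nu>) * ?f x \<le> ennreal (gamma_density \<nu> x) * ennreal (x powr - \<xi>)" for x
  proof (cases "0 < x \<and> x < 1")
    case True
    have "1 / x = x powr (- 1)" using True by (simp add: powr_minus_divide)
    also have "\<dots> \<le> x powr (\<nu> - \<xi> - 1)" using True assms by (intro powr_mono') auto
    finally have "exp (- 1) * (1 / x) \<le> exp (- x) * x powr (\<nu> - \<xi> - 1)"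
      using True by (intro mult_mono) auto
    then have "exp (- 1) / Gamma \<nu> * (1 / x) \<le> gamma_density \<nu> x * x powr - \<xi>"
      unfolding gamma_density_powr using True divide_right_mono[OF _ less_imp_le[OF G]]
      by (fastforce simp: mult.commute)
    then show ?thesis using True G by (auto intro: ennreal_leI simp flip: ennreal_mult'')
  qed auto
  then have "(\<integral>\<^sup>+x. ennreal (exp (- 1) / Gamma \<nu>) * ?f x \<partial>lborel)
      \<le> (\<integral>\<^sup>+x. ennreal (x powr - \<xi>) \<partial>gamma_law \<nu>)"
    by (subst nn_integral_gamma_law) (auto intro!: nn_integral_mono)
  moreover have "(\<integral>\<^sup>+x. ennreal (exp (- 1) / Gamma \<nu>) * ?f x \<partial>lborel) = \<infinity>"
    using G by (subst nn_integral_cmult) (auto simp: nn_integral_inverse_unit_interval ennreal_mult_top)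
  ultimately show ?thesis by (simp add: top.extremum_unique)
qed

text \<open>Both sides are brought to the coordinates \<open>(a, r)\<close> with \<open>b = a r\<close>, where the integral over
  the old \<open>a\<close> is a Gamma integral and \<open>c = a (1 + r)\<close> for the new \<open>a\<close>; this needs
  only linear substitutions.\<close>

lemma gamma_law_beta_gamma:
  fixes g :: "real \<times> real \<Rightarrow> ennreal"
  assumes [measurable]: "g \<in> borel_measurable (borel \<Otimes>\<^sub>M borel)" and pos: "0 < \<theta>" "0 < \<nu>"
  shows "(\<integral>\<^sup>+a. \<integral>\<^sup>+b. \<integral>\<^sup>+c. g (c * a / (a + b), c * b / (a + b)) \<partial>gamma_law (\<theta> + \<nu>) \<partial>gamma_law \<nu> \<partial>gamma_law \<theta>)
    = (\<integral>\<^sup>+a. \<integral>\<^sup>+b. g (a, b) \<partial>gamma_law \<nu> \<partial>gamma_law \<theta>)"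
proof -
  let ?D = "\<lambda>\<nu> x. ennreal (gamma_density \<nu> x)"
  let ?\<mu> = "\<theta> + \<nu>"
  have G: "Gamma \<theta> > 0" "Gamma \<nu> > 0" "Gamma ?\<mu> > 0" using pos by simp_all
  \<comment> \<open>\<open>K\<close> is the density of the ratio \<open>r\<close> of two independent
    Gamma variables, and \<open>H r\<close> is the expectation of \<open>g\<close> given that ratio,
    with the total \<open>c\<close> drawn from \<open>gamma_law (\<theta> + \<nu>)\<close>.\<close>
  define H where "H r = (\<integral>\<^sup>+c. ?D ?\<mu> c * g (c / (1 + r), c * r / (1 + r)) \<partial>lborel)" for r
  define K where "K r = (if 0 < r then r powr (\<nu> - 1) * (1 + r) powr - ?\<mu> * Gamma ?\<mu> / (Gamma \<theta> * Gamma \<nu>) else 0)" for r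
  have [measurable]: "H \<in> borel_measurable borel" unfolding H_def by measurable
  have [measurable]: "K \<in> borel_measurable borel" unfolding K_def by measurable
  have "(\<integral>\<^sup>+a. \<integral>\<^sup>+b. \<integral>\<^sup>+c. g (c * a / (a + b), c * b / (a + b)) \<partial>gamma_law ?\<mu> \<partial>gamma_law \<nu> \<partial>gamma_law \<theta>)
    = (\<integral>\<^sup>+a. ?D \<theta> a * (\<integral>\<^sup>+b. ?D \<nu> b * (\<integral>\<^sup>+c. ?D ?\<mu> c * g (c * a / (a + b), c * b / (a + b)) \<partial>lborel) \<partial>lborel) \<partial>lborel)"
    by (simp add: nn_integral_gamma_law)
  \<comment> \<open>The substitution \<open>b = a * r\<close> frees both fractions of
    \<open>a\<close>. For \<open>a \<le> 0\<close> the density vanishes.\<close>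
  also have "\<dots> = (\<integral>\<^sup>+a. \<integral>\<^sup>+r. ?D \<theta> a * (ennreal a * ?D \<nu> (a * r)) * H r \<partial>lborel \<partial>lborel)"
  proof (rule nn_integral_cong)
    fix a :: real
    show "?D \<theta> a * (\<integral>\<^sup>+b. ?D \<nu> b * (\<integral>\<^sup>+c. ?D ?\<mu> c * g (c * a / (a + b), c * b / (a + b)) \<partial>lborel) \<partial>lborel)
      = (\<integral>\<^sup>+r. ?D \<theta> a * (ennreal a * ?D \<nu> (a * r)) * H r \<partial>lborel)"
    proof (cases "0 < a")
      case True
      have "c * a / (a + a * r) = c / (1 + r)" "c * (a * r) / (a + a * r) = c * r / (1 + r)" for c r
      proof -
        have "a + a * r = a * (1 + r)" by (simp add: algebra_simps)
        then show "c * a / (a + a * r) = c / (1 + r)" "c * (a * r) / (a + a * r) = c * r / (1 + r)"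
          using True by simp_all
      qed
      then have "(\<integral>\<^sup>+b. ?D \<nu> b * (\<integral>\<^sup>+c. ?D ?\<mu> c * g (c * a / (a + b), c * b / (a + b)) \<partial>lborel) \<partial>lborel)
        = ennreal a * (\<integral>\<^sup>+r. ?D \<nu> (a * r) * H r \<partial>lborel)"
        using True by (subst nn_integral_real_affine[where c = a and t = 0]) (auto simp: H_def)
      then show ?thesis
        by (simp add: nn_integral_cmult[symmetric] mult.assoc)
    qed (simp add: gamma_density_def)
  qed
  also have "\<dots> = (\<integral>\<^sup>+r. \<integral>\<^sup>+a. ?D \<theta> a * (ennreal a * ?D \<nu> (a * r)) * H r \<partial>lborel \<partial>lborel)"
    by (rule lborel_pair.Fubini'[symmetric]) measurable
  also have "\<dots> = (\<integral>\<^sup>+r. \<integral>\<^sup>+a. ?D \<theta> a * (ennreal a * ?D \<nu> (a * r)) * g (a, a * r) \<partial>lborel \<partial>lborel)"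
  proof (rule nn_integral_cong)
    fix r :: real
    show "(\<integral>\<^sup>+a. ?D \<theta> a * (ennreal a * ?D \<nu> (a * r)) * H r \<partial>lborel)
      = (\<integral>\<^sup>+a. ?D \<theta> a * (ennreal a * ?D \<nu> (a * r)) * g (a, a * r) \<partial>lborel)"
    proof (cases "0 < r")
      case True
      have H: "H r = ennreal (1 + r) * (\<integral>\<^sup>+a. ?D ?\<mu> ((1 + r) * a) * g (a, a * r) \<partial>lborel)"
      proof -
        have "(1 + r) * a / (1 + r) = a" "(1 + r) * a * r / (1 + r) = a * r" for a
          using True by (simp_all add: divide_simps)
        then show ?thesis
          unfolding H_def using True
          by (subst nn_integral_real_affine[where c = "1 + r" and t = 0]) auto
      qed
      have dens: "gamma_density \<theta> a * (a * gamma_density \<nu> (a * r))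
          = (r powr (\<nu> - 1) / (Gamma \<theta> * Gamma \<nu>)) *
            (if 0 < a then a powr (?\<mu> - 1) * exp (- ((1 + r) * a)) else 0)" for a
      proof (cases "0 < a")
        case a: True
        have "a powr (\<theta> - 1) * (a * a powr (\<nu> - 1)) = a powr (?\<mu> - 1)"
          using a by (simp add: powr_mult_base flip: powr_add) (simp add: algebra_simps)
        moreover have "exp (- ((1 + r) * a)) = exp (- a) * exp (- (a * r))"
          by (simp flip: exp_add) (simp add: algebra_simps)
        ultimately show ?thesis
          using a True by (simp add: gamma_density_def powr_mult zero_less_mult_iff mult_ac)
      qed (simp add: gamma_density_def)
      have prod: "?D \<theta> a * (ennreal a * ?D \<nu> (a * r)) = ennreal (gamma_density \<theta> a * (a * gamma_density \<nu> (a * r)))" for a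
        using True G by (cases "0 < a")
          (auto simp: gamma_density_def zero_less_mult_iff simp flip: ennreal_mult')
      have "(\<integral>\<^sup>+a. ?D \<theta> a * (ennreal a * ?D \<nu> (a * r)) \<partial>lborel)
        = ennreal (r powr (\<nu> - 1) / (Gamma \<theta> * Gamma \<nu>)) *
          (\<integral>\<^sup>+a. ennreal (if 0 < a then a powr (?\<mu> - 1) * exp (- ((1 + r) * a)) else 0) \<partial>lborel)"
        unfolding prod dens using G
        by (subst nn_integral_cmult[symmetric]) (auto intro!: nn_integral_cong simp flip: ennreal_mult')
      also have "\<dots> = ennreal (K r)"
        using True G pos by (subst nn_integral_powr_exp) (auto simp: K_def mult_ac simp flip: ennreal_mult')
      finally have "(\<integral>\<^sup>+a. ?D \<theta> a * (ennreal a * ?D \<nu> (a * r)) * H r \<partial>lborel) = ennreal (K r) * H r"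
        by (subst nn_integral_multc) auto
      also have "\<dots> = ennreal (K r) * (ennreal (1 + r) * (\<integral>\<^sup>+a. ?D ?\<mu> ((1 + r) * a) * g (a, a * r) \<partial>lborel))"
        unfolding H ..
      also have "\<dots>
        = (\<integral>\<^sup>+a. (ennreal (K r) * (ennreal (1 + r) * ?D ?\<mu> ((1 + r) * a))) * g (a, a * r) \<partial>lborel)"
        by (simp add: nn_integral_cmult[symmetric] mult.assoc)
      also have "\<dots> = (\<integral>\<^sup>+a. ?D \<theta> a * (ennreal a * ?D \<nu> (a * r)) * g (a, a * r) \<partial>lborel)"
      proof (rule nn_integral_cong)
        fix a :: real
        \<comment> \<open>Two factorisations of the joint density of \<open>(a, r)\<close>: the
          ratio density times the Gamma density of the total \<open>(1 + r) * a\<close> with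
          Jacobian \<open>1 + r\<close>, and the product of the two Gamma densities with Jacobian
          \<open>a\<close>.\<close>
        have "K r * ((1 + r) * gamma_density ?\<mu> ((1 + r) * a)) = gamma_density \<theta> a * (a * gamma_density \<nu> (a * r))"
        proof (cases "0 < a")
          case a: True
          have "(1 + r) powr - ?\<mu> * ((1 + r) * (1 + r) powr (?\<mu> - 1)) = 1"
            using True by (simp add: powr_mult_base flip: powr_add)
          then have "K r * ((1 + r) * gamma_density ?\<mu> ((1 + r) * a)) =
             (r powr (\<nu> - 1) / (Gamma \<theta> * Gamma \<nu>)) * (a powr (?\<mu> - 1) * exp (- ((1 + r) * a))) *
              ((1 + r) powr - ?\<mu> * ((1 + r) * (1 + r) powr (?\<mu> - 1)))"
            using a True G unfolding K_def gamma_density_def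
            by (simp only: powr_mult) (simp add: zero_less_mult_iff powr_mult del: distrib_right_numeral)
          then show ?thesis
            unfolding dens using a \<open>_ = 1\<close> by simp
        next
          case False
          then show ?thesis using True by (auto simp: gamma_density_def zero_less_mult_iff)
        qed
        moreover have "0 \<le> K r" using True G by (simp add: K_def)
        ultimately show "ennreal (K r) * (ennreal (1 + r) * ?D ?\<mu> ((1 + r) * a)) * g (a, a * r)
          = ?D \<theta> a * (ennreal a * ?D \<nu> (a * r)) * g (a, a * r)"
          unfolding prod using True by (simp flip: ennreal_mult' del: ennreal_plus)
      qed
      finally show ?thesis .
    next
      case False
      then have "?D \<theta> a * (ennreal a * ?D \<nu> (a * r)) = 0" for a
        by (auto simp: gamma_density_def zero_less_mult_iff)
      then show ?thesis by (simp only: mult_zero_left)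
    qed
  qed
  also have "\<dots> = (\<integral>\<^sup>+a. \<integral>\<^sup>+r. ?D \<theta> a * (ennreal a * ?D \<nu> (a * r)) * g (a, a * r) \<partial>lborel \<partial>lborel)"
    by (rule lborel_pair.Fubini') measurable
  also have "\<dots> = (\<integral>\<^sup>+a. ?D \<theta> a * (\<integral>\<^sup>+b. ?D \<nu> b * g (a, b) \<partial>lborel) \<partial>lborel)"
  proof (rule nn_integral_cong)
    fix a :: real
    show "(\<integral>\<^sup>+r. ?D \<theta> a * (ennreal a * ?D \<nu> (a * r)) * g (a, a * r) \<partial>lborel)
      = ?D \<theta> a * (\<integral>\<^sup>+b. ?D \<nu> b * g (a, b) \<partial>lborel)"
    proof (cases "0 < a")
      case True
      have "(\<integral>\<^sup>+b. ?D \<nu> b * g (a, b) \<partial>lborel) = ennreal a * (\<integral>\<^sup>+r. ?D \<nu> (a * r) * g (a, a * r) \<partial>lborel)"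
        using True by (subst nn_integral_real_affine[where c = a and t = 0]) auto
      then show ?thesis
        by (simp add: nn_integral_cmult[symmetric] mult.assoc)
    qed (simp add: gamma_density_def)
  qed
  also have "\<dots> = (\<integral>\<^sup>+a. \<integral>\<^sup>+b. g (a, b) \<partial>gamma_law \<nu> \<partial>gamma_law \<theta>)"
    by (simp add: nn_integral_gamma_law)
  finally show ?thesis .
qed

section \<open>Independence of blocks and the exchange at one corner\<close>

context prob_space
begin

text \<open>Grouped into one block, the variables at \<open>j\<close>, \<open>k\<close>,
  \<open>l\<close> are independent of the others, and inside the block the event for the new pair
  factors by the independence of \<open>A\<close> and \<open>B\<close>. The index \<open>l\<close>
  goes away because three variables are consumed to produce two.\<close>

lemma indep_vars_replace_pair:
  fixes X :: "'i \<Rightarrow> 'a \<Rightarrow> real" and j k l :: 'i and f g :: "real \<times> real \<times> real \<Rightarrow> real"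
  defines "A \<equiv> \<lambda>\<omega>. f (X j \<omega>, X k \<omega>, X l \<omega>)" and "B \<equiv> \<lambda>\<omega>. g (X j \<omega>, X k \<omega>, X l \<omega>)"
  assumes indep: "indep_vars (\<lambda>_. borel) X I" and fin: "finite I"
    and jkl: "j \<in> I" "k \<in> I" "l \<in> I" "j \<noteq> k" "j \<noteq> l" "k \<noteq> l"
    and [measurable]: "f \<in> borel_measurable (borel \<Otimes>\<^sub>M borel \<Otimes>\<^sub>M borel)" "g \<in> borel_measurable (borel \<Otimes>\<^sub>M borel \<Otimes>\<^sub>M borel)"
    and AB: "indep_var borel A borel B"
  shows "indep_vars (\<lambda>_. borel) (X(j := A, k := B)) (I - {l})"
proof -
  let ?X = "X(j := A, k := B)"
  \<comment> \<open>The block \<open>{j, k, l}\<close> is labelled by \<open>j\<close>; every other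
    index is a block of its own.\<close>
  define L where "L = insert j (I - {j, k, l})"
  define K where "K i = (if i = j then {j, k, l} else {i})" for i
  have rv: "random_variable borel (X i)" if "i \<in> I" for i
    using indep that by (auto simp: indep_vars_def)
  have blocks: "indep_vars (\<lambda>i. PiM (K i) (\<lambda>_. borel)) (\<lambda>i \<omega>. restrict (\<lambda>p. X p \<omega>) (K i)) L"
    using jkl by (intro indep_vars_restrict[OF indep]) (auto simp: K_def L_def disjoint_family_on_def)
  have "prob (\<Inter>i\<in>I - {l}. ?X i -` S i \<inter> space M) = (\<Prod>i\<in>I - {l}. prob (?X i -` S i \<inter> space M))"
    if S: "\<And>i. i \<in> I - {l} \<Longrightarrow> S i \<in> sets borel" for S
  proof -
    have [measurable]: "S j \<in> sets borel" "S k \<in> sets borel" using S jkl by auto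
    define E where "E i = (if i = j
      then {w \<in> space (PiM {j, k, l} (\<lambda>_. borel)). f (w j, w k, w l) \<in> S j \<and> g (w j, w k, w l) \<in> S k}
      else {w \<in> space (PiM {i} (\<lambda>_. borel)). w i \<in> S i})" for i :: 'i
    have Esets: "E i \<in> sets (PiM (K i) (\<lambda>_. borel))" if "i \<in> L" for i
    proof (cases "i = j")
      case True
      then show ?thesis unfolding E_def K_def by simp
    next
      case False
      with that have [measurable]: "S i \<in> sets borel" using S by (auto simp: L_def)
      show ?thesis using False unfolding E_def K_def by simp
    qed
    have eqE: "(\<lambda>\<omega>. restrict (\<lambda>p. X p \<omega>) (K i)) -` E i \<inter> space M = ?X i -` S i \<inter> space M"
      if "i \<in> I - {j, k, l}" for i
      using that by (auto simp: K_def E_def space_PiM)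
    have eqj: "(\<lambda>\<omega>. restrict (\<lambda>p. X p \<omega>) (K j)) -` E j \<inter> space M = (?X j -` S j \<inter> space M) \<inter> (?X k -` S k \<inter> space M)"
      using jkl by (auto simp: K_def E_def space_PiM A_def B_def)
    have I: "I - {l} = insert j (insert k (I - {j, k, l}))" using jkl by auto
    have "(\<Inter>i\<in>I - {l}. ?X i -` S i \<inter> space M) = (\<Inter>i\<in>L. (\<lambda>\<omega>. restrict (\<lambda>p. X p \<omega>) (K i)) -` E i \<inter> space M)"
      unfolding I L_def INF_insert eqj using eqE by (auto simp del: fun_upd_apply)
    also have "prob \<dots> = (\<Prod>i\<in>L. prob ((\<lambda>\<omega>. restrict (\<lambda>p. X p \<omega>) (K i)) -` E i \<inter> space M))"
      using fin Esets by (intro indep_varsD_finite[OF blocks]) (auto simp: L_def)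
    also have "\<dots> = prob ((?X j -` S j \<inter> space M) \<inter> (?X k -` S k \<inter> space M)) * (\<Prod>i\<in>I - {j, k, l}. prob (?X i -` S i \<inter> space M))"
      unfolding L_def using fin eqE by (subst prod.insert) (auto simp: eqj simp del: fun_upd_apply)
    also have "prob ((?X j -` S j \<inter> space M) \<inter> (?X k -` S k \<inter> space M)) = prob (?X j -` S j \<inter> space M) * prob (?X k -` S k \<inter> space M)"
    proof -
      have "(?X j -` S j \<inter> space M) \<inter> (?X k -` S k \<inter> space M) = (\<lambda>x. (A x, B x)) -` (S j \<times> S k) \<inter> space M"
        using jkl by auto
      then show ?thesis
        using indep_varD[OF AB, of "S j" "S k"] jkl by simp
    qed
    finally show ?thesis
      unfolding I using fin jkl by (simp add: mult.assoc del: fun_upd_apply)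
  qed
  moreover have "random_variable borel (?X i)" if "i \<in> I - {l}" for i
    using that rv indep_var_rv1[OF AB] indep_var_rv2[OF AB] by auto
  \<comment> \<open>All Borel sets serve as generating family. It is stable under intersection and
    contains the whole space, so the product formula over the full index set suffices.\<close>
  ultimately show ?thesis
    using jkl fin
    by (subst indep_vars_finite[where E = "\<lambda>_. sets borel"])
      (auto simp: sets.sigma_sets_eq[of borel, simplified] Int_stable_def Pi_iff)
qed

text \<open>Done in two stages: \<open>X k\<close> and \<open>X l\<close> are paired first, then
  \<open>X j\<close> is compared with that pair on rectangles.\<close>

lemma distr_triple_indep:
  fixes X :: "'i \<Rightarrow> 'a \<Rightarrow> real" and j k l :: 'i
  assumes indep: "indep_vars (\<lambda>_. borel) X I"
    and jkl: "j \<in> I" "k \<in> I" "l \<in> I" "j \<noteq> k" "j \<noteq> l" "k \<noteq> l"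
  shows "distr M (borel \<Otimes>\<^sub>M borel \<Otimes>\<^sub>M borel) (\<lambda>\<omega>. (X j \<omega>, X k \<omega>, X l \<omega>))
    = distr M borel (X j) \<Otimes>\<^sub>M distr M borel (X k) \<Otimes>\<^sub>M distr M borel (X l)"
proof -
  have rv[measurable]: "random_variable borel (X i)" if "i \<in> {j, k, l}" for i
    using indep that jkl by (auto simp: indep_vars_def)
  have [measurable]: "random_variable borel (X j)" "random_variable borel (X k)" "random_variable borel (X l)"
    by simp_all
  have "indep_var borel ((\<lambda>w. w k) \<circ> (\<lambda>\<omega>. restrict (\<lambda>i. X i \<omega>) {k}))
      borel ((\<lambda>w. w l) \<circ> (\<lambda>\<omega>. restrict (\<lambda>i. X i \<omega>) {l}))"
    using jkl by (intro indep_var_compose[OF indep_var_restrict[OF indep]]) auto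
  then have "indep_var borel (X k) borel (X l)"
    by (simp add: comp_def)
  then have kl: "distr M borel (X k) \<Otimes>\<^sub>M distr M borel (X l) = distr M (borel \<Otimes>\<^sub>M borel) (\<lambda>\<omega>. (X k \<omega>, X l \<omega>))"
    by (simp add: indep_var_distribution_eq)
  have ind: "indep_var (PiM {j} (\<lambda>_. borel)) (\<lambda>\<omega>. restrict (\<lambda>i. X i \<omega>) {j})
      (PiM {k, l} (\<lambda>_. borel)) (\<lambda>\<omega>. restrict (\<lambda>i. X i \<omega>) {k, l})"
    using jkl by (intro indep_var_restrict[OF indep]) auto
  interpret J: prob_space "distr M borel (X j)" by (rule prob_space_distr) simp
  interpret KL: prob_space "distr M (borel \<Otimes>\<^sub>M borel) (\<lambda>\<omega>. (X k \<omega>, X l \<omega>))"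
    by (rule prob_space_distr) simp
  show ?thesis
    unfolding kl
  proof (rule pair_measure_eqI[symmetric])
    fix S T assume "S \<in> sets (distr M borel (X j))" "T \<in> sets (distr M (borel \<Otimes>\<^sub>M borel) (\<lambda>\<omega>. (X k \<omega>, X l \<omega>)))"
    then have [measurable]: "S \<in> sets borel" "T \<in> sets (borel \<Otimes>\<^sub>M borel)" by simp_all
    let ?S = "{w \<in> space (PiM {j} (\<lambda>_. borel)). w j \<in> S}"
    let ?T = "{w \<in> space (PiM {k, l} (\<lambda>_. borel)). (w k, w l) \<in> T}"
    have "prob ((\<lambda>\<omega>. (restrict (\<lambda>i. X i \<omega>) {j}, restrict (\<lambda>i. X i \<omega>) {k, l})) -` (?S \<times> ?T) \<inter> space M)
      = prob ((\<lambda>\<omega>. restrict (\<lambda>i. X i \<omega>) {j}) -` ?S \<inter> space M) * prob ((\<lambda>\<omega>. restrict (\<lambda>i. X i \<omega>) {k, l}) -` ?T \<inter> space M)"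
      by (intro indep_varD[OF ind]) simp_all
    also have "(\<lambda>\<omega>. (restrict (\<lambda>i. X i \<omega>) {j}, restrict (\<lambda>i. X i \<omega>) {k, l})) -` (?S \<times> ?T) \<inter> space M
      = (\<lambda>\<omega>. (X j \<omega>, X k \<omega>, X l \<omega>)) -` (S \<times> T) \<inter> space M"
      by (auto simp: space_PiM)
    also have "(\<lambda>\<omega>. restrict (\<lambda>i. X i \<omega>) {j}) -` ?S \<inter> space M = X j -` S \<inter> space M"
      by (auto simp: space_PiM)
    also have "(\<lambda>\<omega>. restrict (\<lambda>i. X i \<omega>) {k, l}) -` ?T \<inter> space M = (\<lambda>\<omega>. (X k \<omega>, X l \<omega>)) -` T \<inter> space M"
      by (auto simp: space_PiM)
    finally show "emeasure (distr M borel (X j)) S * emeasure (distr M (borel \<Otimes>\<^sub>M borel) (\<lambda>\<omega>. (X k \<omega>, X l \<omega>))) T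
      = emeasure (distr M (borel \<Otimes>\<^sub>M borel \<Otimes>\<^sub>M borel) (\<lambda>\<omega>. (X j \<omega>, X k \<omega>, X l \<omega>))) (S \<times> T)"
      by (simp add: emeasure_distr emeasure_eq_measure ennreal_mult' [symmetric])
  qed (auto intro: J.sigma_finite_measure KL.sigma_finite_measure cong: sets_pair_measure_cong)
qed

text \<open>For independent Gamma variables the fraction \<open>X j / (X j + X k)\<close> is
  independent of the sum \<open>X j + X k\<close>, and this sum has the law of \<open>X l\<close>.
  Exchanging the sum for the independent \<open>X l\<close> therefore preserves the joint law of the
  pair.\<close>

lemma burke_corner:
  fixes X :: "'i \<Rightarrow> 'a \<Rightarrow> real" and j k l :: 'i
  assumes indep: "indep_vars (\<lambda>_. borel) X I"
    and jkl: "j \<in> I" "k \<in> I" "l \<in> I" "j \<noteq> k" "j \<noteq> l" "k \<noteq> l"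
    and pos: "0 < \<theta>" "0 < \<nu>"
    and law: "distr M borel (X j) = gamma_law \<theta>" "distr M borel (X k) = gamma_law \<nu>"
      "distr M borel (X l) = gamma_law (\<theta> + \<nu>)"
  defines "A \<equiv> \<lambda>\<omega>. X l \<omega> * X j \<omega> / (X j \<omega> + X k \<omega>)" and "B \<equiv> \<lambda>\<omega>. X l \<omega> * X k \<omega> / (X j \<omega> + X k \<omega>)"
  shows "indep_var borel A borel B" and "distr M borel A = gamma_law \<theta>" and "distr M borel B = gamma_law \<nu>"
proof -
  interpret P\<theta>: prob_space "gamma_law \<theta>" by (rule prob_space_gamma_law) fact
  interpret P\<nu>: prob_space "gamma_law \<nu>" by (rule prob_space_gamma_law) fact
  interpret P\<mu>: prob_space "gamma_law (\<theta> + \<nu>)" by (rule prob_space_gamma_law) (use pos in simp)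
  interpret P2: pair_prob_space "gamma_law \<nu>" "gamma_law (\<theta> + \<nu>)" ..
  have [measurable]: "random_variable borel (X i)" if "i \<in> {j, k, l}" for i
    using indep that jkl by (auto simp: indep_vars_def)
  have [measurable]: "random_variable borel (X j)" "random_variable borel (X k)" "random_variable borel (X l)"
    by simp_all
  have [measurable]: "random_variable borel A" "random_variable borel B"
    unfolding A_def B_def by measurable
  let ?\<phi> = "\<lambda>(a::real, b, c). (c * a / (a + b), c * b / (a + b))"
  have "distr M (borel \<Otimes>\<^sub>M borel) (\<lambda>\<omega>. (A \<omega>, B \<omega>))
    = distr (distr M (borel \<Otimes>\<^sub>M borel \<Otimes>\<^sub>M borel) (\<lambda>\<omega>. (X j \<omega>, X k \<omega>, X l \<omega>))) (borel \<Otimes>\<^sub>M borel) ?\<phi>"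
    by (subst distr_distr) (auto simp: comp_def A_def B_def)
  also have "\<dots> = distr (gamma_law \<theta> \<Otimes>\<^sub>M gamma_law \<nu> \<Otimes>\<^sub>M gamma_law (\<theta> + \<nu>)) (borel \<Otimes>\<^sub>M borel) ?\<phi>"
    unfolding distr_triple_indep[OF indep jkl] law ..
  also have "\<dots> = gamma_law \<theta> \<Otimes>\<^sub>M gamma_law \<nu>"
  proof (rule measure_eqI)
    fix S assume "S \<in> sets (distr (gamma_law \<theta> \<Otimes>\<^sub>M gamma_law \<nu> \<Otimes>\<^sub>M gamma_law (\<theta> + \<nu>)) (borel \<Otimes>\<^sub>M borel) ?\<phi>)"
    then have [measurable]: "S \<in> sets (borel \<Otimes>\<^sub>M borel)" by simp
    let ?N = "gamma_law \<theta> \<Otimes>\<^sub>M gamma_law \<nu> \<Otimes>\<^sub>M gamma_law (\<theta> + \<nu>)"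
    have "emeasure (distr ?N (borel \<Otimes>\<^sub>M borel) ?\<phi>) S = (\<integral>\<^sup>+z. indicator S z \<partial>distr ?N (borel \<Otimes>\<^sub>M borel) ?\<phi>)"
      by simp
    also have "\<dots> = (\<integral>\<^sup>+z. indicator S (?\<phi> z) \<partial>?N)"
      by (subst nn_integral_distr) auto
    also have "\<dots> = (\<integral>\<^sup>+a. \<integral>\<^sup>+b. \<integral>\<^sup>+c. indicator S (c * a / (a + b), c * b / (a + b))
        \<partial>gamma_law (\<theta> + \<nu>) \<partial>gamma_law \<nu> \<partial>gamma_law \<theta>)"
      by (subst P2.nn_integral_fst[symmetric], measurable, subst P\<mu>.nn_integral_fst[symmetric]) (auto simp: case_prod_beta)
    also have "\<dots> = (\<integral>\<^sup>+a. \<integral>\<^sup>+b. indicator S (a, b) \<partial>gamma_law \<nu> \<partial>gamma_law \<theta>)"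
      by (rule gamma_law_beta_gamma) (use pos in auto)
    also have "\<dots> = emeasure (gamma_law \<theta> \<Otimes>\<^sub>M gamma_law \<nu>) S"
      by (subst P\<nu>.nn_integral_fst) auto
    finally show "emeasure (distr ?N (borel \<Otimes>\<^sub>M borel) ?\<phi>) S = emeasure (gamma_law \<theta> \<Otimes>\<^sub>M gamma_law \<nu>) S" .
  qed (simp cong: sets_pair_measure_cong)
  finally have joint: "distr M (borel \<Otimes>\<^sub>M borel) (\<lambda>\<omega>. (A \<omega>, B \<omega>)) = gamma_law \<theta> \<Otimes>\<^sub>M gamma_law \<nu>" .
  have "distr M borel A = distr (distr M (borel \<Otimes>\<^sub>M borel) (\<lambda>\<omega>. (A \<omega>, B \<omega>))) borel fst"
    by (subst distr_distr) (auto simp: comp_def)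
  also have "\<dots> = distr (gamma_law \<theta> \<Otimes>\<^sub>M gamma_law \<nu>) (gamma_law \<theta>) fst"
    unfolding joint by (rule distr_cong) auto
  finally show lawA: "distr M borel A = gamma_law \<theta>" by (simp add: P\<nu>.distr_pair_fst)
  interpret P12: pair_prob_space "gamma_law \<theta>" "gamma_law \<nu>" ..
  have "distr M borel B = distr (distr M (borel \<Otimes>\<^sub>M borel) (\<lambda>\<omega>. (A \<omega>, B \<omega>))) borel snd"
    by (subst distr_distr) (auto simp: comp_def)
  also have "\<dots> = distr (gamma_law \<theta> \<Otimes>\<^sub>M gamma_law \<nu>) (gamma_law \<nu>) snd"
    unfolding joint by (rule distr_cong) auto
  also have "\<dots> = gamma_law \<nu>"
  proof (rule measure_eqI)
    fix S assume "S \<in> sets (distr (gamma_law \<theta> \<Otimes>\<^sub>M gamma_law \<nu>) (gamma_law \<nu>) snd)"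
    then have S: "S \<in> sets (gamma_law \<nu>)" by simp
    have "snd -` S \<inter> space (gamma_law \<theta> \<Otimes>\<^sub>M gamma_law \<nu>) = space (gamma_law \<theta>) \<times> S"
      by (auto simp: space_pair_measure)
    with S show "emeasure (distr (gamma_law \<theta> \<Otimes>\<^sub>M gamma_law \<nu>) (gamma_law \<nu>) snd) S = emeasure (gamma_law \<nu>) S"
      using P\<theta>.emeasure_space_1
      by (subst emeasure_distr) (auto simp: P\<nu>.emeasure_pair_measure_Times simp del: P\<theta>.emeasure_space_1)
  qed simp
  finally show lawB: "distr M borel B = gamma_law \<nu>" .
  show "indep_var borel A borel B"
    unfolding indep_var_distribution_eq lawA lawB joint by simp
qed

end

section \<open>Partition functions and their ratios\<close>

text \<open>Partition function of the paths into \<open>(m, n)\<close> that leave the vertical axis at some height \<open>k\<close>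
  with boundary weight \<open>b k\<close> in place of the weights collected on the axis.\<close>

fun col_part :: "(nat \<Rightarrow> real) \<Rightarrow> (nat \<times> nat \<Rightarrow> real) \<Rightarrow> nat \<Rightarrow> nat \<Rightarrow> real" where
  "col_part b w 0 n = b n"
| "col_part b w (Suc m) 0 = w (Suc m, 0) * col_part b w m 0"
| "col_part b w (Suc m) (Suc n) = w (Suc m, Suc n) * (col_part b w m (Suc n) + col_part b w (Suc m) n)"

abbreviation axis_prod :: "(nat \<times> nat \<Rightarrow> real) \<Rightarrow> nat \<Rightarrow> real" where
  "axis_prod w n \<equiv> \<Prod>j=1..n. w (0, j)"

text \<open>The boundary mass sits at height \<open>l\<close> and the weights collected on the axis
  are left out. The value is thus a function of the weights off the vertical axis, which makes it
  independent of the axis weights.\<close>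

abbreviation exit_part :: "nat \<Rightarrow> (nat \<times> nat \<Rightarrow> real) \<Rightarrow> nat \<Rightarrow> nat \<Rightarrow> real" where
  "exit_part l \<equiv> col_part (\<lambda>k. of_bool (k = l))"

abbreviation part_fun :: "(nat \<times> nat \<Rightarrow> real) \<Rightarrow> nat \<Rightarrow> nat \<Rightarrow> real" where
  "part_fun w \<equiv> col_part (axis_prod w) w"

text \<open>The scheme mirrors the recursion of \<open>col_part\<close>: the vertical axis is given
  outright, a site of the bottom row depends on its left neighbour and an inner site on two
  neighbours.\<close>

lemma lattice_induct [case_names axis bottom step]:
  assumes "\<And>n. P 0 n" "\<And>m. P m 0 \<Longrightarrow> P (Suc m) 0"
    "\<And>m n. P m (Suc n) \<Longrightarrow> P (Suc m) n \<Longrightarrow> P (Suc m) (Suc n)"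
  shows "P m n"
proof (induction m arbitrary: n)
  case (Suc m)
  then show ?case by (induction n) (blast intro: assms)+
qed (rule assms)

text \<open>The vertical axis enters through \<open>b\<close> alone. The later independence from the
  axis weights rests on this.\<close>

lemma col_part_cong:
  assumes "\<And>p. 0 < fst p \<Longrightarrow> w p = w' p"
  shows "col_part b w m n = col_part b w' m n"
  by (induction m n rule: lattice_induct) (use assms in auto)

lemma col_part_nonneg:
  assumes "\<And>k. 0 \<le> b k" "\<forall>p. p \<noteq> (0, 0) \<longrightarrow> 0 < w p"
  shows "0 \<le> col_part b w m n"
  by (induction m n rule: lattice_induct) (simp_all add: assms less_imp_le)

lemma axis_prod_pos:
  assumes "\<forall>p. p \<noteq> (0, 0) \<longrightarrow> 0 < w p"
  shows "0 < axis_prod w n"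
  using assms by (intro prod_pos) auto

lemma part_fun_pos:
  assumes "\<forall>p. p \<noteq> (0, 0) \<longrightarrow> 0 < w p"
  shows "0 < part_fun w m n"
  by (induction m n rule: lattice_induct) (use axis_prod_pos[OF assms] assms in \<open>simp_all add: add_pos_pos\<close>)

lemma measurable_col_part:
  assumes "\<And>p. 0 < fst p \<Longrightarrow> (\<lambda>x. w x p) \<in> borel_measurable N"
    and "\<And>k. (\<lambda>x. b x k) \<in> borel_measurable N"
  shows "(\<lambda>x. col_part (b x) (w x) m n) \<in> borel_measurable N"
  by (induction m n rule: lattice_induct) (use assms in auto)

text \<open>\<open>col_part\<close> is linear in its boundary values, and \<open>axis_prod w\<close>
  is a combination of unit boundary conditions.\<close>

lemma part_fun_exit_decomposition:
  "part_fun w m n = (\<Sum>l\<le>n. axis_prod w l * exit_part l w m n)"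
proof -
  \<comment> \<open>A fixed bound \<open>N\<close> keeps the range of summation the same while the
    recursion moves between heights.\<close>
  have *: "part_fun w m n = (\<Sum>l\<le>N. axis_prod w l * exit_part l w m n)" if "n \<le> N" for N
    using that
  proof (induction m n rule: lattice_induct)
    case (axis n)
    then show ?case by (simp add: of_bool_def if_distrib cong: if_cong)
  qed (simp_all add: sum_distrib_left distrib_left mult_ac sum.distrib)
  show ?thesis by (rule *) simp
qed

lemma axis_times_exit_part_nonneg:
  assumes "\<forall>p. p \<noteq> (0, 0) \<longrightarrow> 0 < w p"
  shows "0 \<le> axis_prod w l * exit_part l w m n"
  by (intro mult_nonneg_nonneg less_imp_le[OF axis_prod_pos[OF assms]] col_part_nonneg[OF _ assms]) simp

lemma axis_times_exit_part_le:
  assumes "\<forall>p. p \<noteq> (0, 0) \<longrightarrow> 0 < w p" "l \<le> n"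
  shows "axis_prod w l * exit_part l w m n \<le> part_fun w m n"
  unfolding part_fun_exit_decomposition
  using assms(2) axis_times_exit_part_nonneg[OF assms(1)] by (intro member_le_sum) auto

text \<open>Exit at height 0 means a horizontal first step; the reflected term collects the paths
  with a vertical one. At the origin the trivial path would be counted twice.\<close>

lemma part_fun_first_step_decomposition:
  assumes "(m, n) \<noteq> (0, 0)"
  shows "part_fun w m n = exit_part 0 w m n + exit_part 0 (\<lambda>p. w (prod.swap p)) n m"
  using assms
proof (induction m n rule: lattice_induct)
  case (axis n)
  have "exit_part 0 (\<lambda>p. w (prod.swap p)) k 0 = axis_prod w k" for k
    by (induction k) (simp_all add: mult.commute)
  with axis show ?case by simp
next
  case (bottom m)
  then show ?case by (cases m) simp_all
next
  case (step m n)
  then show ?case by (simp add: algebra_simps)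
qed

lemma part_fun_swap: "part_fun (\<lambda>p. w (prod.swap p)) n m = part_fun w m n"
proof (induction m n rule: lattice_induct)
  case (axis n)
  show ?case by (induction n) (simp_all add: mult.commute)
next
  case (bottom m)
  then show ?case by (simp add: mult.commute)
next
  case (step m n)
  then show ?case by (simp add: add.commute)
qed

section \<open>Path sums and the recursion\<close>

lemma directed_paths_0_0: "directed_paths 0 0 = {[(0, 0)]}"
  by (auto simp: directed_paths_def length_Suc_conv)

text \<open>Removing the endpoint leaves a path to the left or the lower neighbour. This matches the
  recursion of \<open>col_part\<close>, which also peels off the last site.\<close>

lemma directed_paths_snoc:
  "xs @ [p] \<in> directed_paths m n \<longleftrightarrow>
    (m, n) = (0, 0) \<and> p = (0, 0) \<and> xs = [] \<or>
    p = (m, n) \<and> (\<exists>m'. m = Suc m' \<and> xs \<in> directed_paths m' n) \<or>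
    p = (m, n) \<and> (\<exists>n'. n = Suc n' \<and> xs \<in> directed_paths m n')"
proof (cases "m + n")
  case 0
  then show ?thesis by (auto simp: directed_paths_def)
next
  case (Suc N)
  \<comment> \<open>\<open>R\<close> describes a directed path with \<open>N\<close> steps and free
    endpoint; the value of \<open>xs ! N\<close> then decides between the two neighbours.\<close>
  define R where "R \<longleftrightarrow> length xs = Suc N \<and> xs ! 0 = (0, 0) \<and>
      (\<forall>k<N. xs ! Suc k = xs ! k + (1, 0) \<or> xs ! Suc k = xs ! k + (0, 1))"
  have 1: "xs @ [p] \<in> directed_paths m n \<longleftrightarrow> R \<and> p = (m, n) \<and> (p = xs ! N + (1, 0) \<or> p = xs ! N + (0, 1))"
    unfolding directed_paths_def R_def using Suc by (auto simp: nth_append less_Suc_eq)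
  have 2: "(m, n) = xs ! N + (1, 0) \<longleftrightarrow> (\<exists>m'. m = Suc m' \<and> xs ! N = (m', n))"
    "(m, n) = xs ! N + (0, 1) \<longleftrightarrow> (\<exists>n'. n = Suc n' \<and> xs ! N = (m, n'))"
    by (cases "xs ! N"; auto)+
  have "xs \<in> directed_paths m' n' \<longleftrightarrow> R \<and> xs ! N = (m', n')" if "m' + n' = N" for m' n'
    unfolding directed_paths_def R_def using that by auto
  then have 3: "(\<exists>m'. m = Suc m' \<and> xs \<in> directed_paths m' n) \<longleftrightarrow> R \<and> (\<exists>m'. m = Suc m' \<and> xs ! N = (m', n))"
    "(\<exists>n'. n = Suc n' \<and> xs \<in> directed_paths m n') \<longleftrightarrow> R \<and> (\<exists>n'. n = Suc n' \<and> xs ! N = (m, n'))"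
    using Suc by auto
  have "(m, n) \<noteq> (0, 0)" using Suc by auto
  then show ?thesis unfolding 1 using 2 3 by blast
qed

definition path_sum :: "(nat \<times> nat \<Rightarrow> real) \<Rightarrow> nat \<Rightarrow> nat \<Rightarrow> real" where
  "path_sum w m n = (\<Sum>x\<in>directed_paths m n. \<Prod>j=1..m + n. w (x ! j))"

text \<open>The appended site sits at position \<open>m + n\<close>. The product starts at position
  1, so the weight at the origin stays out on both sides.\<close>

lemma sum_snoc_paths:
  assumes "m' + n' + 1 = m + n"
  shows "(\<Sum>x\<in>(\<lambda>x. x @ [(m, n)]) ` directed_paths m' n'. \<Prod>j=1..m + n. w (x ! j))
    = w (m, n) * path_sum w m' n'"
proof -
  have "(\<Prod>j=1..m + n. w ((x @ [(m, n)]) ! j)) = w (m, n) * (\<Prod>j=1..m' + n'. w (x ! j))"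
    if "x \<in> directed_paths m' n'" for x
  proof -
    have len: "length x = Suc (m' + n')" using that by (simp add: directed_paths_def)
    have "m + n = Suc (m' + n')" using assms by simp
    then show ?thesis
      using len by (auto simp: nth_append intro!: prod.cong)
  qed
  then show ?thesis
    unfolding path_sum_def sum_distrib_left
    by (subst sum.reindex) (auto simp: inj_on_def intro!: sum.cong)
qed

text \<open>Both sides have the same values on the axes and obey the same recursion.\<close>

lemma path_sum_eq_part_fun: "path_sum w m n = part_fun w m n"
proof -
  have sn: "\<exists>xs p. x = xs @ [p]" if "x \<in> directed_paths m n" for x m n
    using that by (cases x rule: rev_cases) (auto simp: directed_paths_def)
  have 1: "path_sum w 0 (Suc n) = w (0, Suc n) * path_sum w 0 n" for n
  proof -
    have "directed_paths 0 (Suc n) = (\<lambda>x. x @ [(0, Suc n)]) ` directed_paths 0 n"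
      using sn by (fastforce simp: directed_paths_snoc)
    then show ?thesis
      using sum_snoc_paths[of 0 n 0 "Suc n" w] by (simp add: path_sum_def)
  qed
  have 2: "path_sum w (Suc m) 0 = w (Suc m, 0) * path_sum w m 0" for m
  proof -
    have "directed_paths (Suc m) 0 = (\<lambda>x. x @ [(Suc m, 0)]) ` directed_paths m 0"
      using sn by (fastforce simp: directed_paths_snoc)
    then show ?thesis
      using sum_snoc_paths[of m 0 "Suc m" 0 w] by (simp add: path_sum_def)
  qed
  have 3: "path_sum w (Suc m) (Suc n) = w (Suc m, Suc n) * (path_sum w m (Suc n) + path_sum w (Suc m) n)" for m n
  proof -
    let ?A = "(\<lambda>x. x @ [(Suc m, Suc n)]) ` directed_paths m (Suc n)"
    let ?B = "(\<lambda>x. x @ [(Suc m, Suc n)]) ` directed_paths (Suc m) n"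
    have "directed_paths (Suc m) (Suc n) = ?A \<union> ?B"
      using sn by (fastforce simp: directed_paths_snoc)
    \<comment> \<open>Paths from the two sets differ in their last site but one.\<close>
    moreover have "?A \<inter> ?B = {}"
      by (auto simp: directed_paths_def)
    ultimately have "path_sum w (Suc m) (Suc n) = (\<Sum>x\<in>?A. \<Prod>j=1..Suc m + Suc n. w (x ! j))
        + (\<Sum>x\<in>?B. \<Prod>j=1..Suc m + Suc n. w (x ! j))"
      unfolding path_sum_def by (simp only:) (subst sum.union_disjoint, auto simp: finite_directed_paths)
    then show ?thesis
      using sum_snoc_paths[of m "Suc n" "Suc m" "Suc n" w] sum_snoc_paths[of "Suc m" n "Suc m" "Suc n" w]
      by (simp add: distrib_left)
  qed
  have 0: "path_sum w 0 n = part_fun w 0 n" for n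
    by (induction n) (simp_all add: 1 mult.commute, simp add: path_sum_def directed_paths_0_0)
  have "part_fun w m n = path_sum w m n"
    by (induction m n rule: lattice_induct) (simp_all only: 0 2 3 col_part.simps)
  then show ?thesis ..
qed

lemma Z_stat_eq_part_fun: "Z_stat U V Y m n \<omega> = part_fun (\<lambda>p. ext_weight U V Y p \<omega>) m n"
  using path_sum_eq_part_fun[of "\<lambda>p. ext_weight U V Y p \<omega>" m n] by (simp only: Z_stat_def path_sum_def)

text \<open>Inverse horizontal and vertical ratios of neighbouring partition functions, as functions of
  the inverse weights.\<close>

fun hratio vratio :: "(nat \<times> nat \<Rightarrow> real) \<Rightarrow> nat \<Rightarrow> nat \<Rightarrow> real" where
  "hratio c i 0 = c (i, 0)"
| "hratio c 0 (Suc j) = 0"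
| "hratio c (Suc i) (Suc j) = c (Suc i, Suc j) * hratio c (Suc i) j / (hratio c (Suc i) j + vratio c i (Suc j))"
| "vratio c 0 j = c (0, j)"
| "vratio c (Suc i) 0 = 0"
| "vratio c (Suc i) (Suc j) = c (Suc i, Suc j) * vratio c i (Suc j) / (hratio c (Suc i) j + vratio c i (Suc j))"

text \<open>On each unit square the recursion for \<open>Z\<close> turns the inverse ratios on the
  lower and left edges into those on the upper and right edges, by the formulas that define
  \<open>hratio\<close> and \<open>vratio\<close>. The index shifts avoid the filler values of
  \<open>hratio\<close> in column 0 and of \<open>vratio\<close> in row 0.\<close>

lemma ratio_eq:
  assumes pos: "\<forall>p. p \<noteq> (0, 0) \<longrightarrow> 0 < w p"
  defines "c \<equiv> \<lambda>p. inverse (w p)" and "Z \<equiv> part_fun w"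
  shows "hratio c (Suc i) j = Z i j / Z (Suc i) j" "vratio c i (Suc j) = Z i j / Z i (Suc j)"
proof -
  have Z: "0 < Z i j" for i j
    unfolding Z_def using pos by (rule part_fun_pos)
  have h0: "hratio c (Suc i) 0 = Z i 0 / Z (Suc i) 0" for i
    using pos[rule_format, of "(Suc i, 0)"] Z[of i 0] by (simp add: Z_def c_def field_simps)
  have v0: "vratio c 0 (Suc j) = Z 0 j / Z 0 (Suc j)" for j
  proof -
    have "Z 0 (Suc j) = Z 0 j * w (0, Suc j)" by (simp add: Z_def)
    then show ?thesis
      using pos[rule_format, of "(0, Suc j)"] Z[of 0 j] by (simp add: c_def field_simps)
  qed
  have step: "hratio c (Suc i) (Suc j) = Z i (Suc j) / Z (Suc i) (Suc j) \<and>
      vratio c (Suc i) (Suc j) = Z (Suc i) j / Z (Suc i) (Suc j)"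
    if h: "hratio c (Suc i) j = Z i j / Z (Suc i) j" and v: "vratio c i (Suc j) = Z i j / Z i (Suc j)" for i j
  proof -
    define x where "x = Z i j"
    define y where "y = Z (Suc i) j"
    define z where "z = Z i (Suc j)"
    define u where "u = w (Suc i, Suc j)"
    have p: "0 < x" "0 < y" "0 < z" "0 < u" using Z pos by (simp_all add: x_def y_def z_def u_def)
    have "Z (Suc i) (Suc j) = u * (z + y)" by (simp add: Z_def u_def z_def y_def)
    moreover have "x / y + x / z = x * (z + y) / (y * z)" using p by (simp add: field_simps)
    ultimately show ?thesis
      using p h v by (simp add: c_def x_def[symmetric] y_def[symmetric] z_def[symmetric] u_def[symmetric])
        (simp add: field_simps)
  qed
  \<comment> \<open>Outer induction over columns, inner induction upwards: the vertical ratios of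
    one column and the bottom horizontal ratio determine the next column.\<close>
  have "\<forall>j. hratio c (Suc i) j = Z i j / Z (Suc i) j \<and> vratio c i (Suc j) = Z i j / Z i (Suc j)" for i
  proof (induction i)
    case 0
    have "hratio c (Suc 0) j = Z 0 j / Z (Suc 0) j" for j
      by (induction j) (use h0 v0 step in blast)+
    then show ?case using v0 by blast
  next
    case (Suc i)
    have v: "vratio c (Suc i) (Suc j) = Z (Suc i) j / Z (Suc i) (Suc j)" for j
      using Suc step by blast
    have "hratio c (Suc (Suc i)) j = Z (Suc i) j / Z (Suc (Suc i)) j" for j
      by (induction j) (use h0 v step in blast)+
    then show ?case using v by blast
  qed
  then show "hratio c (Suc i) j = Z i j / Z (Suc i) j" "vratio c i (Suc j) = Z i j / Z i (Suc j)"
    by blast+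
qed

text \<open>Telescoping along row \<open>n\<close>, starting on the vertical axis.\<close>

lemma part_fun_eq_prod_hratio:
  assumes pos: "\<forall>p. p \<noteq> (0, 0) \<longrightarrow> 0 < w p"
  shows "part_fun w m n / axis_prod w n = (\<Prod>i=1..m. inverse (hratio (\<lambda>p. inverse (w p)) i n))"
proof (induction m)
  case 0
  have "axis_prod w n \<noteq> 0" using axis_prod_pos[of w n, OF pos] by (metis less_irrefl)
  then show ?case by simp
next
  case (Suc m)
  define Z where "Z = part_fun w"
  define A where "A = axis_prod w n"
  define h where "h i = inverse (hratio (\<lambda>p. inverse (w p)) i n)" for i
  have h: "h (Suc m) = Z (Suc m) n / Z m n"
    unfolding h_def Z_def using ratio_eq(1)[OF pos] by (simp only: inverse_divide)
  have Z: "Z m n \<noteq> 0" using part_fun_pos[OF pos, of m n] unfolding Z_def by (metis less_irrefl)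
  have "Z m n / A = (\<Prod>i=1..m. h i)"
    using Suc by (simp only: Z_def A_def h_def)
  from this[symmetric] have "Z (Suc m) n / A = (\<Prod>i=1..Suc m. h i)"
    using Z h by (simp add: prod.nat_ivl_Suc' mult.commute)
  then show ?case by (simp only: Z_def A_def h_def)
qed

section \<open>Burke property\<close>

text \<open>The shape of the inverse weight at \<open>p\<close>, used later with
  \<open>\<nu> = \<mu> - \<theta>\<close>. During the exchange of rows the axis indices also carry
  the laws of the ratios.\<close>

definition gamma_param :: "real \<Rightarrow> real \<Rightarrow> nat \<times> nat \<Rightarrow> real" where
  "gamma_param \<theta> \<nu> p = (if snd p = 0 then \<theta> else if fst p = 0 then \<nu> else \<theta> + \<nu>)"

lemma gamma_param_pos: "0 < \<theta> \<Longrightarrow> 0 < \<nu> \<Longrightarrow> 0 < gamma_param \<theta> \<nu> p"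
  by (simp add: gamma_param_def)

text \<open>The rows are exchanged one site at a time: \<open>flip k i\<close> follows the down-right path that has
  been moved from height \<open>k\<close> to height \<open>k + 1\<close> in the columns up to \<open>i\<close>. The index \<open>(i', 0)\<close>
  carries the horizontal ratio in column \<open>i'\<close> and \<open>(0, k + 1)\<close> the vertical ratio.\<close>

lemma (in prob_space) burke_row:
  fixes X :: "nat \<times> nat \<Rightarrow> 'a \<Rightarrow> real"
  assumes indep: "indep_vars (\<lambda>_. borel) X (UNIV - {(0, 0)})"
    and law: "\<forall>p. p \<noteq> (0, 0) \<longrightarrow> distr M borel (X p) = gamma_law (gamma_param \<theta> \<nu> p)"
    and pos: "0 < \<theta>" "0 < \<nu>"
  shows "indep_vars (\<lambda>_. borel) (\<lambda>p \<omega>. hratio (\<lambda>q. X q \<omega>) (fst p) n) ({1..m} \<times> {0::nat})"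
    and "\<forall>i\<in>{1..m}. distr M borel (\<lambda>\<omega>. hratio (\<lambda>q. X q \<omega>) i n) = gamma_law \<theta>"
proof -
  \<comment> \<open>Independence and marginal laws are bundled because each corner exchange needs
    both and preserves both.\<close>
  define fam where "fam F I \<longleftrightarrow> indep_vars (\<lambda>_. borel) F I \<and>
    (\<forall>p\<in>I. distr M borel (F p) = gamma_law (gamma_param \<theta> \<nu> p))" for F :: "nat \<times> nat \<Rightarrow> 'a \<Rightarrow> real" and I
  have fam_mono: "fam F I" if "fam F' I'" "I \<subseteq> I'" "\<And>p. p \<in> I \<Longrightarrow> F p = F' p" for F F' I I'
    using that indep_vars_subset[of "\<lambda>_. borel" F' I' I] indep_vars_cong[of I I F F' "\<lambda>_. borel" "\<lambda>_. borel"]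
    by (auto simp: fam_def)
  define h where "h i j \<omega> = hratio (\<lambda>q. X q \<omega>) i j" for i j \<omega>
  define v where "v i j \<omega> = vratio (\<lambda>q. X q \<omega>) i j" for i j \<omega>
  \<comment> \<open>The state after \<open>k\<close> rows: horizontal ratios at height
    \<open>k\<close>, stored at the bottom indices, and the original inverse weights above that
    height. \<open>R k\<close> is its index set.\<close>
  define row where "row k p = (if snd p = 0 then h (fst p) k else X p)" for k p
  define R where "R k = {1..m} \<times> {0} \<union> {0..m} \<times> {Suc k..n}" for k
  define flip where "flip k i p = (if snd p = 0 then (if fst p \<le> i then h (fst p) (Suc k) else h (fst p) k)
    else if p = (0, Suc k) then v i (Suc k) else X p)" for k i p
  \<comment> \<open>The weights at height \<open>k + 1\<close> in the columns already passed have
    been consumed.\<close>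
  define J where "J k i = R k - {1..i} \<times> {Suc k}" for k i
  have flip: "fam (flip k i) (J k i)" if "fam (row k) (R k)" "k < n" "i \<le> m" for k i
    using \<open>i \<le> m\<close>
  proof (induction i)
    case 0
    \<comment> \<open>Before any column is passed, the vertical ratio is the inverse boundary weight
      on the axis.\<close>
    have "flip k 0 p = row k p" if "p \<in> J k 0" for p
      using that by (auto simp: flip_def row_def J_def R_def v_def)
    then show ?case
      by (intro fam_mono[OF \<open>fam (row k) (R k)\<close>]) (auto simp: J_def)
  next
    case (Suc i)
    \<comment> \<open>The next corner: the horizontal ratio below, the vertical ratio to the left
      and the inverse weight at the upper right site.\<close>
    let ?j = "(Suc i, 0)" and ?k = "(0, Suc k)" and ?l = "(Suc i, Suc k)"
    have IH: "indep_vars (\<lambda>_. borel) (flip k i) (J k i)"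
      "\<And>p. p \<in> J k i \<Longrightarrow> distr M borel (flip k i p) = gamma_law (gamma_param \<theta> \<nu> p)"
      using Suc by (auto simp: fam_def)
    have mem: "?j \<in> J k i" "?k \<in> J k i" "?l \<in> J k i" and ne: "?j \<noteq> ?k" "?j \<noteq> ?l" "?k \<noteq> ?l"
      using Suc.prems \<open>k < n\<close> by (auto simp: J_def R_def)
    have vals: "flip k i ?j = h (Suc i) k" "flip k i ?k = v i (Suc k)" "flip k i ?l = X ?l"
      by (auto simp: flip_def)
    have laws: "distr M borel (flip k i ?j) = gamma_law \<theta>" "distr M borel (flip k i ?k) = gamma_law \<nu>"
      "distr M borel (flip k i ?l) = gamma_law (\<theta> + \<nu>)"
      using IH(2) mem by (auto simp: gamma_param_def)
    note corner = burke_corner[OF IH(1) mem ne pos laws, unfolded vals]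
    let ?A = "\<lambda>\<omega>. X ?l \<omega> * h (Suc i) k \<omega> / (h (Suc i) k \<omega> + v i (Suc k) \<omega>)"
    let ?B = "\<lambda>\<omega>. X ?l \<omega> * v i (Suc k) \<omega> / (h (Suc i) k \<omega> + v i (Suc k) \<omega>)"
    have "indep_vars (\<lambda>_. borel) ((flip k i)(?j := ?A, ?k := ?B)) (J k i - {?l})"
      using indep_vars_replace_pair[OF IH(1) _ mem ne,
        of "\<lambda>(a, b, c). c * a / (a + b)" "\<lambda>(a, b, c). c * b / (a + b)", unfolded vals]
        corner(1) by (auto simp: J_def R_def)
    moreover have "(flip k i)(?j := ?A, ?k := ?B) = flip k (Suc i)"
      by (auto simp: fun_eq_iff flip_def h_def v_def)
    moreover have "J k i - {?l} = J k (Suc i)"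
      by (auto simp: J_def)
    moreover have "distr M borel (((flip k i)(?j := ?A, ?k := ?B)) p) = gamma_law (gamma_param \<theta> \<nu> p)"
      if "p \<in> J k i" for p
      using that IH(2)[of p] corner(2,3) by (auto simp: gamma_param_def)
    ultimately show ?case by (auto simp: fam_def)
  qed
  have row: "fam (row k) (R k)" if "k \<le> n" for k
    using that
  proof (induction k)
    case 0
    have "fam X (UNIV - {(0, 0)})" using indep law by (auto simp: fam_def)
    then show ?case by (rule fam_mono) (auto simp: R_def row_def h_def fun_eq_iff)
  next
    case (Suc k)
    \<comment> \<open>Once all \<open>m\<close> columns are passed, restriction to
      \<open>R (Suc k)\<close> drops the vertical ratio left at the right end.\<close>
    then have "fam (flip k m) (J k m)" by (intro flip) auto
    then show ?case by (rule fam_mono) (auto simp: J_def R_def row_def flip_def)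
  qed
  have "fam (\<lambda>p \<omega>. hratio (\<lambda>q. X q \<omega>) (fst p) n) ({1..m} \<times> {0})"
    by (rule fam_mono[OF row[of n]]) (auto simp: R_def row_def h_def fun_eq_iff)
  then show "indep_vars (\<lambda>_. borel) (\<lambda>p \<omega>. hratio (\<lambda>q. X q \<omega>) (fst p) n) ({1..m} \<times> {0::nat})"
    and "\<forall>i\<in>{1..m}. distr M borel (\<lambda>\<omega>. hratio (\<lambda>q. X q \<omega>) i n) = gamma_law \<theta>"
    by (auto simp: fam_def gamma_param_def)
qed

section \<open>Moment bounds\<close>

text \<open>Every term is compared with the largest one. This treats exponents below and above 1
  alike and costs only a power of the number of terms.\<close>

lemma powr_sum_le:
  fixes f :: "'i \<Rightarrow> real"
  assumes "finite S" "S \<noteq> {}" "\<And>i. i \<in> S \<Longrightarrow> 0 \<le> f i" "0 \<le> \<xi>"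
  shows "(\<Sum>i\<in>S. f i) powr \<xi> \<le> real (card S) powr \<xi> * (\<Sum>i\<in>S. f i powr \<xi>)"
proof -
  have "Max (f ` S) \<in> f ` S" using assms by (intro Max_in) auto
  then obtain k where k: "k \<in> S" "Max (f ` S) = f k" by auto
  have "(\<Sum>i\<in>S. f i) \<le> real (card S) * f k"
    using assms k Max_ge[of "f ` S"] by (intro sum_bounded_above) auto
  then have "(\<Sum>i\<in>S. f i) powr \<xi> \<le> (real (card S) * f k) powr \<xi>"
    using assms by (intro powr_mono2) (auto intro: sum_nonneg)
  also have "\<dots> = real (card S) powr \<xi> * f k powr \<xi>"
    using assms k by (simp add: powr_mult)
  also have "\<dots> \<le> real (card S) powr \<xi> * (\<Sum>i\<in>S. f i powr \<xi>)"
    using assms k by (intro mult_left_mono member_le_sum) auto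
  finally show ?thesis .
qed

text \<open>The \<open>\<xi>\<close>-th moment of the reciprocal of a Gamma variable of shape
  \<open>\<nu>\<close>; its logarithm is the finite value of
  \<open>M_fun \<nu> \<xi>\<close>.\<close>

definition gamma_moment :: "real \<Rightarrow> real \<Rightarrow> real" where
  "gamma_moment \<nu> \<xi> = Gamma (\<nu> - \<xi>) / Gamma \<nu>"

lemma gamma_moment_pos: "0 < \<nu> \<Longrightarrow> \<xi> < \<nu> \<Longrightarrow> 0 < gamma_moment \<nu> \<xi>"
  by (simp add: gamma_moment_def)

text \<open>Log-convexity of \<open>Gamma\<close>, with \<open>\<nu>\<close> the midpoint of
  \<open>\<nu> - \<xi>\<close> and \<open>\<nu> + \<xi>\<close>.\<close>

lemma gamma_moment_mult_ge_1:
  assumes "\<bar>\<xi>\<bar> < \<nu>"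
  shows "1 \<le> gamma_moment \<nu> \<xi> * gamma_moment \<nu> (- \<xi>)"
proof -
  have pos: "0 < \<nu>" "0 < \<nu> - \<xi>" "0 < \<nu> + \<xi>" using assms by auto
  then have G: "0 < Gamma \<nu>" "0 < Gamma (\<nu> - \<xi>)" "0 < Gamma (\<nu> + \<xi>)" by simp_all
  have "(ln \<circ> Gamma) ((1 - 1 / 2) *\<^sub>R (\<nu> - \<xi>) + (1 / 2) *\<^sub>R (\<nu> + \<xi>))
      \<le> (1 - 1 / 2) * (ln \<circ> Gamma) (\<nu> - \<xi>) + (1 / 2) * (ln \<circ> Gamma) (\<nu> + \<xi>)"
    using pos by (intro convex_onD[OF log_convex_Gamma_real]) auto
  then have "2 * ln (Gamma \<nu>) \<le> ln (Gamma (\<nu> - \<xi>)) + ln (Gamma (\<nu> + \<xi>))"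
    by (simp add: field_simps)
  then have "ln (Gamma \<nu> * Gamma \<nu>) \<le> ln (Gamma (\<nu> - \<xi>) * Gamma (\<nu> + \<xi>))"
    using G by (simp add: ln_mult)
  then show ?thesis
    using G by (simp add: gamma_moment_def divide_simps ln_le_cancel_iff)
qed

context stationary_log_gamma
begin

abbreviation W :: "nat \<times> nat \<Rightarrow> 'a \<Rightarrow> real" where
  "W \<equiv> ext_weight U V Y"

text \<open>Reflection in the diagonal exchanges the axes and turns \<open>\<theta>\<close> into
  \<open>\<mu> - \<theta>\<close>, so every estimate relative to the vertical axis has a transposed
  version.\<close>

lemma swap_model: "stationary_log_gamma M \<mu> (\<mu> - \<theta>) V U (\<lambda>p. Y (prod.swap p))"
  and ext_weight_swap: "ext_weight V U (\<lambda>p. Y (prod.swap p)) p = W (prod.swap p)"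
proof -
  show sw: "ext_weight V U (\<lambda>p. Y (prod.swap p)) p = W (prod.swap p)" for p
    by (cases "(U, V, Y, p)" rule: ext_weight.cases) auto
  let ?I = "UNIV - {(0, 0)} :: (nat \<times> nat) set"
  \<comment> \<open>Independence is carried over to the reflected indices by treating them as
    disjoint singleton blocks.\<close>
  have "indep_vars (\<lambda>p. PiM {prod.swap p} (\<lambda>_. borel)) (\<lambda>p \<omega>. restrict (\<lambda>q. W q \<omega>) {prod.swap p}) ?I"
    by (rule indep_vars_restrict[OF indep]) (auto simp: disjoint_family_on_def)
  then have "indep_vars (\<lambda>_. borel) (\<lambda>p \<omega>. (\<lambda>w. w (prod.swap p)) (restrict (\<lambda>q. W q \<omega>) {prod.swap p})) ?I"
    by (rule indep_vars_compose2) simp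
  moreover have "(\<lambda>p \<omega>. (\<lambda>w. w (prod.swap p)) (restrict (\<lambda>q. W q \<omega>) {prod.swap p})) = ext_weight V U (\<lambda>p. Y (prod.swap p))"
    by (simp add: fun_eq_iff sw)
  ultimately show "stationary_log_gamma M \<mu> (\<mu> - \<theta>) V U (\<lambda>p. Y (prod.swap p))"
    using theta_pos theta_less dist_U dist_V dist_Y by unfold_locales auto
qed

lemma rv_W [measurable]: "p \<noteq> (0, 0) \<Longrightarrow> random_variable borel (W p)"
  using indep by (auto simp: indep_vars_def)

lemma law_W:
  assumes "p \<noteq> (0, 0)"
  shows "distr M borel (\<lambda>\<omega>. inverse (W p \<omega>)) = gamma_law (gamma_param \<theta> (\<mu> - \<theta>) p)"
proof -
  have "distributed M lborel (\<lambda>\<omega>. inverse (W p \<omega>)) (gamma_density (gamma_param \<theta> (\<mu> - \<theta>) p))"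
    using assms dist_U dist_V dist_Y
    by (cases "(U, V, Y, p)" rule: ext_weight.cases) (auto simp: gamma_param_def)
  then show ?thesis
    unfolding gamma_law_def by (subst distributed_distr_eq_density[symmetric]) (auto intro: distr_cong)
qed

lemma AE_W_pos: "AE \<omega> in M. \<forall>p. p \<noteq> (0, 0) \<longrightarrow> 0 < W p \<omega>"
proof (subst AE_all_countable, intro allI)
  fix p :: "nat \<times> nat"
  show "AE \<omega> in M. p \<noteq> (0, 0) \<longrightarrow> 0 < W p \<omega>"
  proof (cases "p = (0, 0)")
    case False
    have "AE x in distr M borel (\<lambda>\<omega>. inverse (W p \<omega>)). 0 < x"
      unfolding law_W[OF False] by (rule AE_gamma_law_pos)
    then show ?thesis using False by (subst (asm) AE_distr_iff) auto
  qed simp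
qed

lemma moment_W:
  assumes "p \<noteq> (0, 0)"
  shows "\<xi> < gamma_param \<theta> (\<mu> - \<theta>) p \<Longrightarrow>
      (\<integral>\<^sup>+\<omega>. ennreal (W p \<omega> powr \<xi>) \<partial>M) = ennreal (gamma_moment (gamma_param \<theta> (\<mu> - \<theta>) p) \<xi>)"
    and "gamma_param \<theta> (\<mu> - \<theta>) p \<le> \<xi> \<Longrightarrow> (\<integral>\<^sup>+\<omega>. ennreal (W p \<omega> powr \<xi>) \<partial>M) = \<infinity>"
proof -
  have "(\<integral>\<^sup>+\<omega>. ennreal (W p \<omega> powr \<xi>) \<partial>M) = (\<integral>\<^sup>+x. ennreal (x powr - \<xi>) \<partial>gamma_law (gamma_param \<theta> (\<mu> - \<theta>) p))"
    using assms unfolding law_W[OF assms, symmetric]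
    by (subst nn_integral_distr) (auto simp: inverse_powr powr_minus)
  moreover have "0 < gamma_param \<theta> (\<mu> - \<theta>) p"
    using theta_pos theta_less by (intro gamma_param_pos) auto
  ultimately show "\<xi> < gamma_param \<theta> (\<mu> - \<theta>) p \<Longrightarrow>
      (\<integral>\<^sup>+\<omega>. ennreal (W p \<omega> powr \<xi>) \<partial>M) = ennreal (gamma_moment (gamma_param \<theta> (\<mu> - \<theta>) p) \<xi>)"
    and "gamma_param \<theta> (\<mu> - \<theta>) p \<le> \<xi> \<Longrightarrow> (\<integral>\<^sup>+\<omega>. ennreal (W p \<omega> powr \<xi>) \<partial>M) = \<infinity>"
    by (simp_all add: gamma_law_moment gamma_law_moment_infinite gamma_moment_def)
qed

lemma moment_V:
  assumes "0 < j" "\<xi> < \<mu> - \<theta>"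
  shows "(\<integral>\<^sup>+\<omega>. ennreal (W (0, j) \<omega> powr \<xi>) \<partial>M) = ennreal (gamma_moment (\<mu> - \<theta>) \<xi>)"
  using moment_W(1)[of "(0, j)" \<xi>] assms by (simp add: gamma_param_def)

text \<open>By the Burke property the quotient is a product of \<open>m\<close> independent
  reciprocals of variables with law \<open>gamma_law \<theta>\<close>, whatever the height
  \<open>n\<close>.\<close>

lemma ratio_moment:
  assumes "\<xi> < \<theta>"
  shows "(\<integral>\<^sup>+\<omega>. ennreal ((part_fun (\<lambda>p. W p \<omega>) m n / axis_prod (\<lambda>p. W p \<omega>) n) powr \<xi>) \<partial>M)
    = ennreal (gamma_moment \<theta> \<xi> ^ m)"
proof -
  let ?X = "\<lambda>p \<omega>. inverse (W p \<omega>)"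
  let ?h = "\<lambda>i \<omega>. hratio (\<lambda>q. ?X q \<omega>) i n"
  have pos: "0 < \<theta>" "0 < \<mu> - \<theta>" using theta_pos theta_less by auto
  have ind: "indep_vars (\<lambda>_. borel) ?X (UNIV - {(0, 0)})"
    by (rule indep_vars_compose2[OF indep]) simp
  have law: "\<forall>p. p \<noteq> (0, 0) \<longrightarrow> distr M borel (?X p) = gamma_law (gamma_param \<theta> (\<mu> - \<theta>) p)"
    using law_W by blast
  note row = burke_row[OF ind law pos, where n = n and m = m]
  have rv: "random_variable borel (?h i)" if "i \<in> {1..m}" for i
    using row(1) that by (auto simp: indep_vars_def)
  have "(\<integral>\<^sup>+\<omega>. ennreal ((part_fun (\<lambda>p. W p \<omega>) m n / axis_prod (\<lambda>p. W p \<omega>) n) powr \<xi>) \<partial>M)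
    = (\<integral>\<^sup>+\<omega>. (\<Prod>p\<in>{1..m} \<times> {0::nat}. ennreal (?h (fst p) \<omega> powr - \<xi>)) \<partial>M)"
  proof (rule nn_integral_cong_AE)
    show "AE \<omega> in M. ennreal ((part_fun (\<lambda>p. W p \<omega>) m n / axis_prod (\<lambda>p. W p \<omega>) n) powr \<xi>)
      = (\<Prod>p\<in>{1..m} \<times> {0::nat}. ennreal (?h (fst p) \<omega> powr - \<xi>))"
      using AE_W_pos
    proof eventually_elim
      case (elim \<omega>)
      have hpos: "0 < ?h i \<omega>" if "i \<in> {1..m}" for i
        using that ratio_eq(1)[OF elim, of "i - 1" n] part_fun_pos[OF elim] by simp
      have "(part_fun (\<lambda>p. W p \<omega>) m n / axis_prod (\<lambda>p. W p \<omega>) n) powr \<xi> = (\<Prod>i=1..m. inverse (?h i \<omega>) powr \<xi>)"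
        unfolding part_fun_eq_prod_hratio[OF elim] using hpos by (intro prod_powr_distrib) 
      also have "\<dots> = (\<Prod>i=1..m. ?h i \<omega> powr - \<xi>)"
        by (simp add: inverse_powr powr_minus)
      also have "\<dots> = (\<Prod>p\<in>{1..m} \<times> {0::nat}. ?h (fst p) \<omega> powr - \<xi>)"
        by (intro prod.reindex_bij_witness[of _ fst "\<lambda>i. (i, 0)"]) auto
      finally show ?case by (simp only: prod_ennreal powr_ge_zero)
    qed
  qed
  also have "\<dots> = (\<Prod>p\<in>{1..m} \<times> {0::nat}. \<integral>\<^sup>+\<omega>. ennreal (?h (fst p) \<omega> powr - \<xi>) \<partial>M)"
    by (intro indep_vars_nn_integral indep_vars_compose2[OF row(1)]) auto
  also have "\<dots> = (\<Prod>p\<in>{1..m} \<times> {0::nat}. ennreal (gamma_moment \<theta> \<xi>))"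
  proof (rule prod.cong)
    fix p assume "p \<in> {1..m} \<times> {0::nat}"
    then have p: "fst p \<in> {1..m}" by auto
    have "(\<integral>\<^sup>+\<omega>. ennreal (?h (fst p) \<omega> powr - \<xi>) \<partial>M) = (\<integral>\<^sup>+x. ennreal (x powr - \<xi>) \<partial>distr M borel (?h (fst p)))"
      using rv[OF p] by (subst nn_integral_distr) auto
    also have "\<dots> = ennreal (gamma_moment \<theta> \<xi>)"
      using row(2)[rule_format, OF p] gamma_law_moment[OF pos(1) assms] by (simp add: gamma_moment_def)
    finally show "(\<integral>\<^sup>+\<omega>. ennreal (?h (fst p) \<omega> powr - \<xi>) \<partial>M) = ennreal (gamma_moment \<theta> \<xi>)" .
  qed simp
  also have "\<dots> = ennreal (gamma_moment \<theta> \<xi> ^ m)"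
    using gamma_moment_pos[OF pos(1) assms] by (simp add: ennreal_power less_imp_le)
  finally show ?thesis .
qed

lemma measurable_exit_part [measurable]:
  "(\<lambda>\<omega>. exit_part l (\<lambda>p. W p \<omega>) m n) \<in> borel_measurable M"
  by (rule measurable_col_part) auto

lemma measurable_part_fun [measurable]:
  "(\<lambda>\<omega>. part_fun (\<lambda>p. W p \<omega>) m n) \<in> borel_measurable M"
  by (rule measurable_col_part) (auto intro!: borel_measurable_prod)

text \<open>The sites off the vertical axis form one block and each axis site another. Label 0
  stands for the former, hence \<open>0 \<notin> J\<close>. Working in \<open>ennreal\<close> admits
  infinite moments.\<close>

lemma exit_part_indep_axis:
  assumes J: "finite J" "0 \<notin> J"
  shows "(\<integral>\<^sup>+\<omega>. ennreal (exit_part l (\<lambda>p. W p \<omega>) m n powr \<xi>) * (\<Prod>j\<in>J. ennreal (W (0, j) \<omega> powr \<eta>)) \<partial>M)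
    = (\<integral>\<^sup>+\<omega>. ennreal (exit_part l (\<lambda>p. W p \<omega>) m n powr \<xi>) \<partial>M) * (\<Prod>j\<in>J. \<integral>\<^sup>+\<omega>. ennreal (W (0, j) \<omega> powr \<eta>) \<partial>M)"
proof -
  define K where "K j = (if j = 0 then {p. 0 < fst p} else {(0 :: nat, j)})" for j :: nat
  define \<Phi> where "\<Phi> j w = (if j = 0 then ennreal (exit_part l w m n powr \<xi>) else ennreal (w (0, j) powr \<eta>))"
    for j and w :: "nat \<times> nat \<Rightarrow> real"
  have \<Phi>K: "\<Phi> j (restrict (\<lambda>p. W p \<omega>) (K j)) = \<Phi> j (\<lambda>p. W p \<omega>)" for j \<omega>
    using col_part_cong[of "restrict (\<lambda>p. W p \<omega>) (K 0)" "\<lambda>p. W p \<omega>"] by (simp add: \<Phi>_def K_def)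
  have meas: "\<Phi> j \<in> borel_measurable (PiM (K j) (\<lambda>_. borel))" for j
  proof (cases "j = 0")
    case True
    have "(\<lambda>w. exit_part l w m n) \<in> borel_measurable (PiM (K 0) (\<lambda>_. borel))"
      by (rule measurable_col_part) (auto simp: K_def)
    then show ?thesis using True by (simp add: \<Phi>_def[abs_def])
  qed (simp add: \<Phi>_def[abs_def] K_def)
  have "indep_vars (\<lambda>j. PiM (K j) (\<lambda>_. borel)) (\<lambda>j \<omega>. restrict (\<lambda>p. W p \<omega>) (K j)) (insert 0 J)"
    by (rule indep_vars_restrict[OF indep]) (auto simp: K_def disjoint_family_on_def)
  then have "indep_vars (\<lambda>_. borel) (\<lambda>j \<omega>. \<Phi> j (restrict (\<lambda>p. W p \<omega>) (K j))) (insert 0 J)"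
    by (rule indep_vars_compose2) (rule meas)
  then have "(\<integral>\<^sup>+\<omega>. (\<Prod>j\<in>insert 0 J. \<Phi> j (\<lambda>p. W p \<omega>)) \<partial>M) = (\<Prod>j\<in>insert 0 J. \<integral>\<^sup>+\<omega>. \<Phi> j (\<lambda>p. W p \<omega>) \<partial>M)"
    unfolding \<Phi>K using J by (intro indep_vars_nn_integral) auto
  \<comment> \<open>\<open>F\<close> stands for evaluation at a sample point or for expectation, so
    one congruence serves both products.\<close>
  moreover have "(\<Prod>j\<in>J. F (\<Phi> j)) = (\<Prod>j\<in>J. F (\<lambda>w. ennreal (w (0, j) powr \<eta>)))" for F :: "_ \<Rightarrow> ennreal"
  proof (rule prod.cong)
    fix j assume "j \<in> J"
    then have "j \<noteq> 0" using J by metis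
    then show "F (\<Phi> j) = F (\<lambda>w. ennreal (w (0, j) powr \<eta>))" by (simp add: \<Phi>_def[abs_def])
  qed simp
  from this[of "\<lambda>f. f (\<lambda>p. W p _)"] this[of "\<lambda>f. \<integral>\<^sup>+\<omega>. f (\<lambda>p. W p \<omega>) \<partial>M"]
  have "(\<Prod>j\<in>J. \<Phi> j (\<lambda>p. W p \<omega>)) = (\<Prod>j\<in>J. ennreal (W (0, j) \<omega> powr \<eta>))"
    "(\<Prod>j\<in>J. \<integral>\<^sup>+\<omega>. \<Phi> j (\<lambda>p. W p \<omega>) \<partial>M) = (\<Prod>j\<in>J. \<integral>\<^sup>+\<omega>. ennreal (W (0, j) \<omega> powr \<eta>) \<partial>M)" for \<omega>
    by simp_all
  ultimately show ?thesis
    using J by (simp add: \<Phi>_def)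
qed

lemma exit_part_indep_V:
  assumes "0 \<notin> J" "finite J" "\<eta> < \<mu> - \<theta>"
  shows "(\<integral>\<^sup>+\<omega>. ennreal (exit_part l (\<lambda>p. W p \<omega>) m n powr \<xi> * (\<Prod>j\<in>J. W (0, j) \<omega> powr \<eta>)) \<partial>M)
    = (\<integral>\<^sup>+\<omega>. ennreal (exit_part l (\<lambda>p. W p \<omega>) m n powr \<xi>) \<partial>M) * ennreal (gamma_moment (\<mu> - \<theta>) \<eta> ^ card J)"
proof -
  have "0 \<le> gamma_moment (\<mu> - \<theta>) \<eta>"
    using gamma_moment_pos[of "\<mu> - \<theta>" \<eta>] assms theta_less by simp
  moreover have "(\<Prod>j\<in>J. \<integral>\<^sup>+\<omega>. ennreal (W (0, j) \<omega> powr \<eta>) \<partial>M) = (\<Prod>j\<in>J. ennreal (gamma_moment (\<mu> - \<theta>) \<eta>))"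
    using assms by (intro prod.cong moment_V) (auto intro: gr0I)
  ultimately show ?thesis
    using exit_part_indep_axis[of J l m n \<xi> \<eta>] assms
    by (simp add: ennreal_mult' prod_ennreal prod_nonneg ennreal_power)
qed

text \<open>The inequality \<open>exit_part 0 \<le> part_fun\<close> is divided by the axis product.
  On the smaller side the factors are independent; on the larger side \<open>ratio_moment\<close>
  gives the value.\<close>

lemma horizontal_start_bound:
  assumes "0 \<le> \<xi>" "\<xi> < \<theta>"
  shows "(\<integral>\<^sup>+\<omega>. ennreal (exit_part 0 (\<lambda>p. W p \<omega>) m n powr \<xi>) \<partial>M) * ennreal (gamma_moment (\<mu> - \<theta>) (- \<xi>) ^ n)
    \<le> ennreal (gamma_moment \<theta> \<xi> ^ m)"
proof -
  have "(\<integral>\<^sup>+\<omega>. ennreal (exit_part 0 (\<lambda>p. W p \<omega>) m n powr \<xi>) \<partial>M) * ennreal (gamma_moment (\<mu> - \<theta>) (- \<xi>) ^ n)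
    = (\<integral>\<^sup>+\<omega>. ennreal (exit_part 0 (\<lambda>p. W p \<omega>) m n powr \<xi> * (\<Prod>j=1..n. W (0, j) \<omega> powr - \<xi>)) \<partial>M)"
    using assms theta_less by (subst exit_part_indep_V) auto
  also have "\<dots> \<le> (\<integral>\<^sup>+\<omega>. ennreal ((part_fun (\<lambda>p. W p \<omega>) m n / axis_prod (\<lambda>p. W p \<omega>) n) powr \<xi>) \<partial>M)"
  proof (rule nn_integral_mono_AE)
    show "AE \<omega> in M. ennreal (exit_part 0 (\<lambda>p. W p \<omega>) m n powr \<xi> * (\<Prod>j=1..n. W (0, j) \<omega> powr - \<xi>))
      \<le> ennreal ((part_fun (\<lambda>p. W p \<omega>) m n / axis_prod (\<lambda>p. W p \<omega>) n) powr \<xi>)"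
      using AE_W_pos
    proof eventually_elim
      case (elim \<omega>)
      let ?w = "\<lambda>p. W p \<omega>"
      have nonneg: "0 \<le> exit_part 0 ?w m n" by (rule col_part_nonneg[OF _ elim]) simp
      have le: "exit_part 0 ?w m n \<le> part_fun ?w m n"
        using axis_times_exit_part_le[OF elim, of 0 n m] by simp
      have "exit_part 0 ?w m n powr \<xi> * (\<Prod>j=1..n. W (0, j) \<omega> powr - \<xi>)
        = (exit_part 0 ?w m n / axis_prod ?w n) powr \<xi>"
        unfolding powr_divide prod_powr_distrib by (simp add: divide_inverse powr_minus prod_inversef[symmetric])
      also have "\<dots> \<le> (part_fun ?w m n / axis_prod ?w n) powr \<xi>"
        using le nonneg axis_prod_pos[OF elim, of n] assms by (intro powr_mono2 divide_right_mono divide_nonneg_pos) auto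
      finally show ?case by (rule ennreal_leI)
    qed
  qed
  also have "\<dots> = ennreal (gamma_moment \<theta> \<xi> ^ m)"
    by (rule ratio_moment) fact
  finally show ?thesis .
qed

text \<open>In the exponent \<open>\<xi> + 1\<close>, the part \<open>\<xi>\<close> comes from the
  power of a sum over \<open>n + 1\<close> exit heights and the 1 from adding up
  \<open>n + 1\<close> equal bounds.\<close>

lemma lower_bound:
  assumes "0 \<le> \<xi>" "\<xi> < \<theta>" "\<xi> < \<mu> - \<theta>"
  shows "ennreal (gamma_moment \<theta> \<xi> ^ m) \<le> ennreal (real (Suc n) powr (\<xi> + 1)) *
    ((\<integral>\<^sup>+\<omega>. ennreal (part_fun (\<lambda>p. W p \<omega>) m n powr \<xi>) \<partial>M) * ennreal (gamma_moment (\<mu> - \<theta>) (- \<xi>) ^ n))"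
proof -
  let ?e = "\<lambda>l \<omega>. exit_part l (\<lambda>p. W p \<omega>) m n"
  let ?Z = "\<lambda>\<omega>. part_fun (\<lambda>p. W p \<omega>) m n"
  define v where "v = gamma_moment (\<mu> - \<theta>) \<xi>"
  define v' where "v' = gamma_moment (\<mu> - \<theta>) (- \<xi>)"
  have v: "0 < v" "0 < v'" "1 \<le> v * v'"
    using assms theta_less by (auto simp: v_def v'_def intro!: gamma_moment_pos gamma_moment_mult_ge_1)
  let ?c = "real (Suc n) powr \<xi>"
  have "ennreal (gamma_moment \<theta> \<xi> ^ m) = (\<integral>\<^sup>+\<omega>. ennreal ((?Z \<omega> / axis_prod (\<lambda>p. W p \<omega>) n) powr \<xi>) \<partial>M)"
    using assms by (subst ratio_moment) auto
  also have "\<dots> \<le> (\<integral>\<^sup>+\<omega>. ennreal ?c * (\<Sum>l\<le>n. ennreal (?e l \<omega> powr \<xi> * (\<Prod>j=Suc l..n. W (0, j) \<omega> powr - \<xi>))) \<partial>M)"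
  proof (rule nn_integral_mono_AE)
    show "AE \<omega> in M. ennreal ((?Z \<omega> / axis_prod (\<lambda>p. W p \<omega>) n) powr \<xi>)
      \<le> ennreal ?c * (\<Sum>l\<le>n. ennreal (?e l \<omega> powr \<xi> * (\<Prod>j=Suc l..n. W (0, j) \<omega> powr - \<xi>)))"
      using AE_W_pos
    proof eventually_elim
      case (elim \<omega>)
      let ?w = "\<lambda>p. W p \<omega>"
      let ?f = "\<lambda>l. axis_prod ?w l * ?e l \<omega> / axis_prod ?w n"
      have f0: "0 \<le> ?f l" for l
        by (intro divide_nonneg_pos axis_times_exit_part_nonneg[OF elim] axis_prod_pos[OF elim])
      have f: "?f l powr \<xi> = ?e l \<omega> powr \<xi> * (\<Prod>j=Suc l..n. W (0, j) \<omega> powr - \<xi>)" if "l \<le> n" for l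
      proof -
        \<comment> \<open>The axis weights up to the exit height cancel; the inverses of those above
          it remain.\<close>
        have "axis_prod ?w n = axis_prod ?w l * (\<Prod>j=Suc l..n. ?w (0, j))"
          using that prod.ub_add_nat[of 1 l "\<lambda>j. ?w (0, j)" "n - l"] by simp
        moreover have "axis_prod ?w l \<noteq> 0"
          using axis_prod_pos[OF elim, of l] by (metis less_irrefl)
        ultimately have "?f l = ?e l \<omega> / (\<Prod>j=Suc l..n. ?w (0, j))"
          by (simp only: nonzero_mult_divide_mult_cancel_left not_False_eq_True)
        then show ?thesis
          by (simp only: powr_divide prod_powr_distrib) (simp add: divide_inverse powr_minus prod_inversef[symmetric])
      qed
      have "(?Z \<omega> / axis_prod ?w n) powr \<xi> = (\<Sum>l\<le>n. ?f l) powr \<xi>"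
        unfolding part_fun_exit_decomposition[of ?w m n] sum_divide_distrib ..
      also have "\<dots> \<le> real (card {..n}) powr \<xi> * (\<Sum>l\<le>n. ?f l powr \<xi>)"
        using f0 assms by (intro powr_sum_le) auto
      also have "\<dots> = ?c * (\<Sum>l\<le>n. ?e l \<omega> powr \<xi> * (\<Prod>j=Suc l..n. W (0, j) \<omega> powr - \<xi>))"
        using f by simp
      finally have "ennreal ((?Z \<omega> / axis_prod ?w n) powr \<xi>)
        \<le> ennreal (?c * (\<Sum>l\<le>n. ?e l \<omega> powr \<xi> * (\<Prod>j=Suc l..n. W (0, j) \<omega> powr - \<xi>)))"
        by (rule ennreal_leI)
      also have "\<dots> = ennreal ?c * (\<Sum>l\<le>n. ennreal (?e l \<omega> powr \<xi> * (\<Prod>j=Suc l..n. W (0, j) \<omega> powr - \<xi>)))"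
        by (subst sum_ennreal) (auto intro!: mult_nonneg_nonneg prod_nonneg ennreal_mult'[OF powr_ge_zero])
      finally show ?case .
    qed
  qed
  also have "\<dots> = ennreal ?c * (\<Sum>l\<le>n. \<integral>\<^sup>+\<omega>. ennreal (?e l \<omega> powr \<xi> * (\<Prod>j=Suc l..n. W (0, j) \<omega> powr - \<xi>)) \<partial>M)"
    by (simp add: nn_integral_cmult nn_integral_sum)
  also have "\<dots> \<le> ennreal ?c * (\<Sum>l\<le>n. (\<integral>\<^sup>+\<omega>. ennreal (?Z \<omega> powr \<xi>) \<partial>M) * ennreal (v' ^ n))"
  proof (intro mult_left_mono sum_mono)
    fix l assume "l \<in> {..n}"
    then have l: "l \<le> n" by simp
    have "(\<integral>\<^sup>+\<omega>. ennreal (?e l \<omega> powr \<xi> * (\<Prod>j=Suc l..n. W (0, j) \<omega> powr - \<xi>)) \<partial>M)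
      = (\<integral>\<^sup>+\<omega>. ennreal (?e l \<omega> powr \<xi>) \<partial>M) * ennreal (v' ^ (n - l))"
      using assms theta_less by (subst exit_part_indep_V) (auto simp: v'_def)
    \<comment> \<open>Multiplying by \<open>(v * v') ^ l\<close>, which is at least 1, completes the
      power of \<open>v'\<close> and supplies the moment \<open>v ^ l\<close> of the axis weights
      below the exit. The full term of \<open>part_fun\<close> can then be reassembled.\<close>
    also have "\<dots> \<le> (\<integral>\<^sup>+\<omega>. ennreal (?e l \<omega> powr \<xi>) \<partial>M) * ennreal (v ^ l * v' ^ n)"
    proof (intro mult_left_mono ennreal_leI)
      have "1 \<le> (v * v') ^ l" using v by (intro one_le_power) auto
      then have "v' ^ (n - l) * 1 \<le> v' ^ (n - l) * (v * v') ^ l"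
        using v by (intro mult_left_mono) auto
      also have "\<dots> = v ^ l * v' ^ n"
        using l by (simp add: power_mult_distrib flip: power_add)
      finally show "v' ^ (n - l) \<le> v ^ l * v' ^ n" by simp
    qed simp
    also have "\<dots> = (\<integral>\<^sup>+\<omega>. ennreal (?e l \<omega> powr \<xi>) \<partial>M) * ennreal (v ^ l) * ennreal (v' ^ n)"
      using v by (simp add: ennreal_mult' mult.assoc)
    also have "(\<integral>\<^sup>+\<omega>. ennreal (?e l \<omega> powr \<xi>) \<partial>M) * ennreal (v ^ l)
      = (\<integral>\<^sup>+\<omega>. ennreal (?e l \<omega> powr \<xi> * (\<Prod>j=1..l. W (0, j) \<omega> powr \<xi>)) \<partial>M)"
      using assms by (subst exit_part_indep_V) (auto simp: v_def)
    also have "\<dots> \<le> (\<integral>\<^sup>+\<omega>. ennreal (?Z \<omega> powr \<xi>) \<partial>M)"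
    proof (rule nn_integral_mono_AE)
      show "AE \<omega> in M. ennreal (?e l \<omega> powr \<xi> * (\<Prod>j=1..l. W (0, j) \<omega> powr \<xi>)) \<le> ennreal (?Z \<omega> powr \<xi>)"
        using AE_W_pos
      proof eventually_elim
        case (elim \<omega>)
        let ?w = "\<lambda>p. W p \<omega>"
        have "axis_prod ?w l * ?e l \<omega> \<le> ?Z \<omega>"
          using l by (rule axis_times_exit_part_le[OF elim])
        then have "(axis_prod ?w l * ?e l \<omega>) powr \<xi> \<le> ?Z \<omega> powr \<xi>"
          using axis_times_exit_part_nonneg[OF elim] assms by (intro powr_mono2) auto
        also have "(axis_prod ?w l * ?e l \<omega>) powr \<xi> = ?e l \<omega> powr \<xi> * (\<Prod>j=1..l. W (0, j) \<omega> powr \<xi>)"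
          by (simp only: powr_mult prod_powr_distrib mult.commute)
        finally show ?case by (rule ennreal_leI)
      qed
    qed
    finally show "(\<integral>\<^sup>+\<omega>. ennreal (?e l \<omega> powr \<xi> * (\<Prod>j=Suc l..n. W (0, j) \<omega> powr - \<xi>)) \<partial>M)
      \<le> (\<integral>\<^sup>+\<omega>. ennreal (?Z \<omega> powr \<xi>) \<partial>M) * ennreal (v' ^ n)"
      by (simp add: mult_right_mono)
  qed simp
  also have "\<dots> = ennreal (?c * real (Suc n)) * ((\<integral>\<^sup>+\<omega>. ennreal (?Z \<omega> powr \<xi>) \<partial>M) * ennreal (v' ^ n))"
    by (simp add: ennreal_mult' mult.assoc ennreal_of_nat_eq_real_of_nat)
  also have "?c * real (Suc n) = real (Suc n) powr (\<xi> + 1)"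
    by (simp add: powr_add)
  finally show ?thesis unfolding v'_def .
qed

end

section \<open>Auxiliary estimates for the limits\<close>

lemma ennreal_le_divide:
  assumes "I * ennreal c \<le> ennreal d" "0 < c"
  shows "I \<le> ennreal (d / c)"
proof -
  have "I = I * ennreal c * ennreal (1 / c)"
    using assms(2) by (simp add: mult.assoc flip: ennreal_mult')
  also have "\<dots> \<le> ennreal d * ennreal (1 / c)"
    using assms(1) by (rule mult_right_mono) simp
  also have "\<dots> = ennreal (d / c)"
    using assms(2) by (simp flip: ennreal_mult'')
  finally show ?thesis .
qed

text \<open>The horizontal path from the axis at the final height has positive weight.\<close>

lemma exit_part_at_end_pos:
  assumes "\<forall>p. p \<noteq> (0, 0) \<longrightarrow> 0 < w p"
  shows "0 < exit_part n w m n"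
proof (induction m)
  case (Suc m)
  then show ?case
    using assms col_part_nonneg[OF _ assms, of "\<lambda>k. of_bool (k = n)" "Suc m"]
    by (cases n) (auto intro!: mult_pos_pos add_pos_nonneg)
qed simp

lemma M_fun_eq: "0 < \<nu> \<Longrightarrow> M_fun \<nu> \<xi> = (if \<xi> < \<nu> then ereal (ln (gamma_moment \<nu> \<xi>)) else \<infinity>)"
  by (auto simp: M_fun_def gamma_moment_def ln_divide_pos)

lemma ln_ennreal_ennreal: "0 < r \<Longrightarrow> ln_ennreal (ennreal r) = ereal (ln r)"
  by (simp add: ln_ennreal_def)

lemma tendsto_nat_floor_div: "(\<lambda>N. real (nat \<lfloor>real N * s\<rfloor>) / real N) \<longlonglongrightarrow> s" if "0 \<le> s"
proof (rule real_tendsto_sandwich)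
  show "\<forall>\<^sub>F N in sequentially. s - 1 / real N \<le> real (nat \<lfloor>real N * s\<rfloor>) / real N"
    using eventually_gt_at_top[of 0]
  proof eventually_elim
    case (elim N)
    have "real N * s - 1 \<le> real (nat \<lfloor>real N * s\<rfloor>)" by linarith
    then have "(real N * s - 1) / real N \<le> real (nat \<lfloor>real N * s\<rfloor>) / real N"
      by (rule divide_right_mono) simp
    then show ?case using elim by (simp add: diff_divide_distrib)
  qed
  show "\<forall>\<^sub>F N in sequentially. real (nat \<lfloor>real N * s\<rfloor>) / real N \<le> s"
    using eventually_gt_at_top[of 0]
  proof eventually_elim
    case (elim N)
    have "real (nat \<lfloor>real N * s\<rfloor>) \<le> real N * s" using that by (simp add: of_nat_nat)
    then show ?case using elim by (simp add: divide_simps mult.commute)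
  qed
  show "(\<lambda>N. s - 1 / real N) \<longlonglongrightarrow> s"
    using tendsto_diff[OF tendsto_const[of s] lim_1_over_n] by simp
qed simp

text \<open>Factors polynomial in the coordinates vanish on the exponential scale.\<close>

lemma tendsto_ln_floor_div:
  assumes "0 \<le> s" "0 \<le> t"
  shows "(\<lambda>N. ln (real (Suc (nat \<lfloor>real N * s\<rfloor> + nat \<lfloor>real N * t\<rfloor>))) / real N) \<longlonglongrightarrow> 0"
proof (rule real_tendsto_sandwich)
  show "\<forall>\<^sub>F N in sequentially. 0 \<le> ln (real (Suc (nat \<lfloor>real N * s\<rfloor> + nat \<lfloor>real N * t\<rfloor>))) / real N"
    by (intro always_eventually) simp
  show "\<forall>\<^sub>F N in sequentially. ln (real (Suc (nat \<lfloor>real N * s\<rfloor> + nat \<lfloor>real N * t\<rfloor>))) / real N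
      \<le> ln (real N) / real N + ln (s + t + 1) * (1 / real N)"
    using eventually_gt_at_top[of 0]
  proof eventually_elim
    case (elim N)
    have "real (nat \<lfloor>real N * s\<rfloor>) \<le> real N * s" "real (nat \<lfloor>real N * t\<rfloor>) \<le> real N * t"
      using assms by (simp_all add: of_nat_nat)
    \<comment> \<open>The 1 from \<open>Suc\<close> is absorbed because \<open>N\<close> is at least
      1.\<close>
    then have "real (Suc (nat \<lfloor>real N * s\<rfloor> + nat \<lfloor>real N * t\<rfloor>)) \<le> real N * (s + t + 1)"
      using elim by (simp add: algebra_simps)
    then have "ln (real (Suc (nat \<lfloor>real N * s\<rfloor> + nat \<lfloor>real N * t\<rfloor>))) \<le> ln (real N * (s + t + 1))"
      by simp
    also have "\<dots> = ln (real N) + ln (s + t + 1)"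
      using elim assms by (intro ln_mult_pos) auto
    finally have "ln (real (Suc (nat \<lfloor>real N * s\<rfloor> + nat \<lfloor>real N * t\<rfloor>))) / real N
        \<le> (ln (real N) + ln (s + t + 1)) / real N"
      by (rule divide_right_mono) simp
    then show ?case by (simp add: add_divide_distrib)
  qed
  show "(\<lambda>N. ln (real N) / real N + ln (s + t + 1) * (1 / real N)) \<longlonglongrightarrow> 0"
    using tendsto_add[OF lim_ln_over_n tendsto_mult_right_zero[OF lim_1_over_n, of "ln (s + t + 1)"]] by simp
qed simp

section \<open>Moments of the partition function and their growth rates\<close>

context stationary_log_gamma
begin

definition moment_Z :: "real \<Rightarrow> nat \<Rightarrow> nat \<Rightarrow> ennreal" where
  "moment_Z \<xi> m n = (\<integral>\<^sup>+\<omega>. ennreal (part_fun (\<lambda>p. W p \<omega>) m n powr \<xi>) \<partial>M)"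

text \<open>\<open>powr\<close> agrees with the exponential of a multiple of \<open>ln\<close> at
  nonzero base, and the partition function is positive almost surely.\<close>

lemma moment_Z_eq: "(\<integral>\<^sup>+\<omega>. ennreal (exp (\<xi> * ln (Z_stat U V Y m n \<omega>))) \<partial>M) = moment_Z \<xi> m n"
  unfolding moment_Z_def
proof (rule nn_integral_cong_AE)
  show "AE \<omega> in M. ennreal (exp (\<xi> * ln (Z_stat U V Y m n \<omega>))) = ennreal (part_fun (\<lambda>p. W p \<omega>) m n powr \<xi>)"
    using AE_W_pos
  proof eventually_elim
    case (elim \<omega>)
    have "part_fun (\<lambda>p. W p \<omega>) m n \<noteq> 0"
      using part_fun_pos[OF elim, of m n] by (metis less_irrefl)
    then show ?case by (simp only: Z_stat_eq_part_fun powr_def if_False)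
  qed
qed

lemma moment_Z_swap:
  "stationary_log_gamma.moment_Z M V U (\<lambda>p. Y (prod.swap p)) \<xi> n m = moment_Z \<xi> m n"
proof -
  interpret sw: stationary_log_gamma M \<mu> "\<mu> - \<theta>" V U "\<lambda>p. Y (prod.swap p)"
    by (rule swap_model)
  show ?thesis
    unfolding sw.moment_Z_def moment_Z_def ext_weight_swap part_fun_swap[of "\<lambda>p. W p _"] ..
qed

lemma moment_Z_axis:
  "moment_Z \<xi> 0 n = (if \<xi> < \<mu> - \<theta> then ennreal (gamma_moment (\<mu> - \<theta>) \<xi>) else \<infinity>) ^ n"
proof -
  let ?c = "if \<xi> < \<mu> - \<theta> then ennreal (gamma_moment (\<mu> - \<theta>) \<xi>) else \<infinity>"
  \<comment> \<open>The inserted \<open>exit_part 0\<close> at the origin equals 1 and brings the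
    axis product into the form of \<open>exit_part_indep_axis\<close>.\<close>
  have "moment_Z \<xi> 0 n = (\<integral>\<^sup>+\<omega>. ennreal (exit_part 0 (\<lambda>p. W p \<omega>) 0 0 powr 0) *
      (\<Prod>j\<in>{1..n}. ennreal (W (0, j) \<omega> powr \<xi>)) \<partial>M)"
    by (simp add: moment_Z_def prod_powr_distrib prod_ennreal)
  also have "\<dots> = (\<Prod>j\<in>{1..n}. \<integral>\<^sup>+\<omega>. ennreal (W (0, j) \<omega> powr \<xi>) \<partial>M)"
    by (subst exit_part_indep_axis) (auto simp: emeasure_space_1)
  also have "\<dots> = (\<Prod>j\<in>{1..n}. ?c)"
  proof (rule prod.cong)
    fix j assume "j \<in> {1..n}"
    then show "(\<integral>\<^sup>+\<omega>. ennreal (W (0, j) \<omega> powr \<xi>) \<partial>M) = ?c"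
      using moment_V[of j \<xi>] moment_W(2)[of "(0, j)" \<xi>] by (auto simp: gamma_param_def)
  qed simp
  finally show ?thesis by simp
qed

text \<open>The path that climbs the whole axis and then runs horizontally already has infinite
  moment.\<close>

lemma moment_Z_infinite_vertical:
  assumes "\<mu> - \<theta> \<le> \<xi>" "0 < n"
  shows "moment_Z \<xi> m n = \<infinity>"
proof -
  let ?e = "\<lambda>\<omega>. exit_part n (\<lambda>p. W p \<omega>) m n"
  have inf: "(\<Prod>j\<in>{1..n}. \<integral>\<^sup>+\<omega>. ennreal (W (0, j) \<omega> powr \<xi>) \<partial>M) = \<infinity>"
  proof -
    have "(\<Prod>j\<in>{1..n}. \<integral>\<^sup>+\<omega>. ennreal (W (0, j) \<omega> powr \<xi>) \<partial>M) = (\<Prod>j\<in>{1..n}. (\<infinity>::ennreal))"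
      using assms by (intro prod.cong moment_W(2)) (auto simp: gamma_param_def)
    then show ?thesis using assms(2) by (simp add: top_power_ennreal)
  qed
  \<comment> \<open>Zero times infinity is zero in \<open>ennreal\<close>, so the moment of the
    off-axis factor has to be shown nonzero.\<close>
  have "(\<integral>\<^sup>+\<omega>. ennreal (?e \<omega> powr \<xi>) \<partial>M) \<noteq> 0"
  proof
    assume "(\<integral>\<^sup>+\<omega>. ennreal (?e \<omega> powr \<xi>) \<partial>M) = 0"
    then have "AE \<omega> in M. ennreal (?e \<omega> powr \<xi>) = 0"
      by (subst (asm) nn_integral_0_iff_AE) auto
    then have "AE \<omega> in M. False"
      using AE_W_pos
    proof eventually_elim
      case (elim \<omega>)
      have "0 < ?e \<omega>" by (rule exit_part_at_end_pos) fact
      then show False using elim by simp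
    qed
    then show False by simp
  qed
  then have "\<infinity> = (\<integral>\<^sup>+\<omega>. ennreal (?e \<omega> powr \<xi>) \<partial>M) * (\<Prod>j\<in>{1..n}. \<integral>\<^sup>+\<omega>. ennreal (W (0, j) \<omega> powr \<xi>) \<partial>M)"
    unfolding inf by (simp add: ennreal_mult_top)
  also have "\<dots> = (\<integral>\<^sup>+\<omega>. ennreal (?e \<omega> powr \<xi>) * (\<Prod>j\<in>{1..n}. ennreal (W (0, j) \<omega> powr \<xi>)) \<partial>M)"
    by (rule exit_part_indep_axis[symmetric]) auto
  also have "\<dots> \<le> moment_Z \<xi> m n"
    unfolding moment_Z_def
  proof (rule nn_integral_mono_AE)
    show "AE \<omega> in M. ennreal (?e \<omega> powr \<xi>) * (\<Prod>j\<in>{1..n}. ennreal (W (0, j) \<omega> powr \<xi>))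
      \<le> ennreal (part_fun (\<lambda>p. W p \<omega>) m n powr \<xi>)"
      using AE_W_pos
    proof eventually_elim
      case (elim \<omega>)
      let ?w = "\<lambda>p. W p \<omega>"
      have "axis_prod ?w n * ?e \<omega> \<le> part_fun ?w m n"
        by (rule axis_times_exit_part_le[OF elim]) simp
      then have "(axis_prod ?w n * ?e \<omega>) powr \<xi> \<le> part_fun ?w m n powr \<xi>"
        using axis_prod_pos[OF elim, of n] exit_part_at_end_pos[OF elim, of n m] assms theta_less
        by (intro powr_mono2) auto
      also have "(axis_prod ?w n * ?e \<omega>) powr \<xi> = ?e \<omega> powr \<xi> * (\<Prod>j\<in>{1..n}. W (0, j) \<omega> powr \<xi>)"
        by (simp only: powr_mult prod_powr_distrib mult.commute)
      finally show ?case
        by (simp add: prod_ennreal ennreal_leI flip: ennreal_mult')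
    qed
  qed
  finally show ?thesis by (simp add: top.extremum_unique)
qed

text \<open>From an inner endpoint both boundaries are accessible, so the smaller threshold
  decides.\<close>

lemma moment_Z_infinite:
  assumes "min \<theta> (\<mu> - \<theta>) \<le> \<xi>" "0 < m" "0 < n"
  shows "moment_Z \<xi> m n = \<infinity>"
proof (cases "\<mu> - \<theta> \<le> \<xi>")
  case True
  then show ?thesis using moment_Z_infinite_vertical assms by simp
next
  case False
  interpret sw: stationary_log_gamma M \<mu> "\<mu> - \<theta>" V U "\<lambda>p. Y (prod.swap p)"
    by (rule swap_model)
  show ?thesis
    using sw.moment_Z_infinite_vertical[of \<xi> m n] False assms by (simp add: moment_Z_swap min_def split: if_splits)
qed

text \<open>Split by the first step; \<open>horizontal_start_bound\<close> controls one part in the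
  model and the other in its reflection.\<close>

lemma moment_Z_upper:
  assumes "0 \<le> \<xi>" "\<xi> < \<theta>" "\<xi> < \<mu> - \<theta>" "(m, n) \<noteq> (0, 0)"
  shows "moment_Z \<xi> m n \<le> ennreal (2 powr \<xi> *
    (gamma_moment \<theta> \<xi> ^ m / gamma_moment (\<mu> - \<theta>) (- \<xi>) ^ n + gamma_moment (\<mu> - \<theta>) \<xi> ^ n / gamma_moment \<theta> (- \<xi>) ^ m))"
proof -
  interpret sw: stationary_log_gamma M \<mu> "\<mu> - \<theta>" V U "\<lambda>p. Y (prod.swap p)"
    by (rule swap_model)
  let ?A = "\<lambda>\<omega>. exit_part 0 (\<lambda>p. W p \<omega>) m n"
  let ?B = "\<lambda>\<omega>. exit_part 0 (\<lambda>p. sw.W p \<omega>) n m"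
  let ?a = "gamma_moment \<theta> \<xi> ^ m / gamma_moment (\<mu> - \<theta>) (- \<xi>) ^ n"
  let ?b = "gamma_moment (\<mu> - \<theta>) \<xi> ^ n / gamma_moment \<theta> (- \<xi>) ^ m"
  have g: "0 < gamma_moment \<theta> (- \<xi>)" "0 < gamma_moment (\<mu> - \<theta>) (- \<xi>)"
    "0 < gamma_moment \<theta> \<xi>" "0 < gamma_moment (\<mu> - \<theta>) \<xi>"
    using assms by (auto intro!: gamma_moment_pos)
  have A: "(\<integral>\<^sup>+\<omega>. ennreal (?A \<omega> powr \<xi>) \<partial>M) \<le> ennreal ?a"
    using g by (intro ennreal_le_divide horizontal_start_bound assms) auto
  have B: "(\<integral>\<^sup>+\<omega>. ennreal (?B \<omega> powr \<xi>) \<partial>M) \<le> ennreal ?b"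
    using g sw.horizontal_start_bound[of \<xi> n m] assms by (intro ennreal_le_divide) auto
  have "moment_Z \<xi> m n \<le> (\<integral>\<^sup>+\<omega>. ennreal (2 powr \<xi>) * (ennreal (?A \<omega> powr \<xi>) + ennreal (?B \<omega> powr \<xi>)) \<partial>M)"
    unfolding moment_Z_def
  proof (rule nn_integral_mono_AE)
    show "AE \<omega> in M. ennreal (part_fun (\<lambda>p. W p \<omega>) m n powr \<xi>)
      \<le> ennreal (2 powr \<xi>) * (ennreal (?A \<omega> powr \<xi>) + ennreal (?B \<omega> powr \<xi>))"
      using AE_W_pos
    proof eventually_elim
      case (elim \<omega>)
      have elim': "\<forall>p. p \<noteq> (0, 0) \<longrightarrow> 0 < sw.W p \<omega>"
        using elim by (auto simp: ext_weight_swap)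
      have "part_fun (\<lambda>p. W p \<omega>) m n = ?A \<omega> + ?B \<omega>"
        unfolding ext_weight_swap using assms(4) by (rule part_fun_first_step_decomposition)
      \<comment> \<open>The two parts are indexed by truth values, so that
        \<open>powr_sum_le\<close> yields the factor \<open>2 powr \<xi>\<close>.\<close>
      moreover have "(\<Sum>i\<in>{False, True}. if i then ?A \<omega> else ?B \<omega>) powr \<xi>
        \<le> real (card {False, True}) powr \<xi> * (\<Sum>i\<in>{False, True}. (if i then ?A \<omega> else ?B \<omega>) powr \<xi>)"
        using col_part_nonneg[OF _ elim, of "\<lambda>k. of_bool (k = 0)" m n]
          col_part_nonneg[OF _ elim', of "\<lambda>k. of_bool (k = 0)" n m] assms
        by (intro powr_sum_le) auto
      ultimately have "part_fun (\<lambda>p. W p \<omega>) m n powr \<xi> \<le> 2 powr \<xi> * (?A \<omega> powr \<xi> + ?B \<omega> powr \<xi>)"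
        by (simp add: add.commute)
      then have "ennreal (part_fun (\<lambda>p. W p \<omega>) m n powr \<xi>) \<le> ennreal (2 powr \<xi> * (?A \<omega> powr \<xi> + ?B \<omega> powr \<xi>))"
        by (rule ennreal_leI)
      then show ?case by (simp add: ennreal_mult')
    qed
  qed
  also have "\<dots> = ennreal (2 powr \<xi>) * ((\<integral>\<^sup>+\<omega>. ennreal (?A \<omega> powr \<xi>) \<partial>M) + (\<integral>\<^sup>+\<omega>. ennreal (?B \<omega> powr \<xi>) \<partial>M))"
    by (simp add: nn_integral_cmult nn_integral_add)
  also have "\<dots> \<le> ennreal (2 powr \<xi>) * (ennreal ?a + ennreal ?b)"
    by (intro mult_left_mono add_mono A B) simp
  also have "\<dots> = ennreal (2 powr \<xi> * (?a + ?b))"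
    using g by (simp add: ennreal_mult')
  finally show ?thesis .
qed

text \<open>\<open>D\<close> is the limiting maximum with \<open>m\<close> and \<open>n\<close> in
  place of \<open>s\<close> and \<open>t\<close>. The error is logarithmic from below and constant
  from above.\<close>

lemma ln_moment_Z_bounds:
  assumes \<xi>: "0 \<le> \<xi>" "\<xi> < \<theta>" "\<xi> < \<mu> - \<theta>" and mn: "(m, n) \<noteq> (0, 0)"
  defines "D \<equiv> max (real m * ln (gamma_moment \<theta> \<xi>) - real n * ln (gamma_moment (\<mu> - \<theta>) (- \<xi>)))
      (real n * ln (gamma_moment (\<mu> - \<theta>) \<xi>) - real m * ln (gamma_moment \<theta> (- \<xi>)))"
  obtains r where "moment_Z \<xi> m n = ennreal r" "0 < r"
    "D - (\<xi> + 1) * ln (real (Suc (m + n))) \<le> ln r" "ln r \<le> D + (\<xi> + 1) * ln 2"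
proof -
  interpret sw: stationary_log_gamma M \<mu> "\<mu> - \<theta>" V U "\<lambda>p. Y (prod.swap p)"
    by (rule swap_model)
  define u where "u = gamma_moment \<theta> \<xi>"
  define u' where "u' = gamma_moment \<theta> (- \<xi>)"
  define v where "v = gamma_moment (\<mu> - \<theta>) \<xi>"
  define v' where "v' = gamma_moment (\<mu> - \<theta>) (- \<xi>)"
  have g: "0 < u" "0 < u'" "0 < v" "0 < v'"
    using \<xi> by (auto simp: u_def u'_def v_def v'_def intro!: gamma_moment_pos)
  define c where "c = real (Suc (m + n)) powr (\<xi> + 1)"
  have c: "0 < c" by (simp add: c_def)
  obtain r where r: "moment_Z \<xi> m n = ennreal r" "0 \<le> r"
    using moment_Z_upper[OF \<xi> mn] by (cases "moment_Z \<xi> m n") (auto simp: top_unique)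
  have up: "r \<le> 2 powr \<xi> * (u ^ m / v' ^ n + v ^ n / u' ^ m)"
    using moment_Z_upper[OF \<xi> mn] g unfolding r(1) u_def u'_def v_def v'_def
    by (subst (asm) ennreal_le_iff) (auto intro!: mult_nonneg_nonneg add_nonneg_nonneg)
  \<comment> \<open>The two lower bounds carry powers of \<open>Suc n\<close> and
    \<open>Suc m\<close>; both are weakened to the common factor \<open>c\<close>.\<close>
  have low: "a \<le> c * (r * b)"
    if "ennreal a \<le> ennreal (real (Suc k) powr (\<xi> + 1)) * (ennreal r * ennreal b)" "k \<le> m + n" "0 < b" for a b k
  proof -
    have "ennreal a \<le> ennreal (real (Suc k) powr (\<xi> + 1) * (r * b))"
      using that r(2) by (simp add: ennreal_mult')
    then have "a \<le> real (Suc k) powr (\<xi> + 1) * (r * b)"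
      using r(2) that by (subst (asm) ennreal_le_iff) auto
    also have "\<dots> \<le> c * (r * b)"
      unfolding c_def using that \<xi> r(2) by (intro mult_right_mono powr_mono2) auto
    finally show ?thesis .
  qed
  have low1: "u ^ m \<le> c * (r * v' ^ n)"
    using lower_bound[OF \<xi>, of m n] g unfolding moment_Z_def[symmetric] r(1)
    by (intro low[of "u ^ m" n "v' ^ n"]) (auto simp: u_def v'_def)
  have low2: "v ^ n \<le> c * (r * u' ^ m)"
    using sw.lower_bound[of \<xi> n m] \<xi> g unfolding sw.moment_Z_def[symmetric] moment_Z_swap r(1)
    by (intro low[of "v ^ n" m "u' ^ m"]) (auto simp: v_def u'_def)
  have "0 < r"
  proof (rule ccontr)
    assume "\<not> 0 < r"
    then have "u ^ m \<le> 0" using low1 r(2) by simp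
    moreover have "0 < u ^ m" using g by simp
    ultimately show False by simp
  qed
  define x where "x = real m * ln u - real n * ln v'"
  define y where "y = real n * ln v - real m * ln u'"
  have D: "D = max x y" by (simp add: D_def x_def y_def u_def u'_def v_def v'_def)
  have ex: "u ^ m / v' ^ n = exp x" "v ^ n / u' ^ m = exp y"
    using g by (simp_all add: x_def y_def exp_diff exp_of_nat_mult)
  have "ln (u ^ m) \<le> ln (c * (r * v' ^ n))" "ln (v ^ n) \<le> ln (c * (r * u' ^ m))"
    using low1 low2 g c \<open>0 < r\<close> by (simp_all add: ln_le_cancel_iff)
  then have "x \<le> ln c + ln r" "y \<le> ln c + ln r"
    using g c \<open>0 < r\<close> by (simp_all add: ln_mult ln_realpow x_def y_def)
  then have lower: "D - (\<xi> + 1) * ln (real (Suc (m + n))) \<le> ln r"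
    by (simp add: D c_def)
  \<comment> \<open>The factor 2 raises the constant \<open>2 powr \<xi>\<close> to
    \<open>2 powr (\<xi> + 1)\<close>.\<close>
  have "exp x + exp y \<le> 2 * exp D" unfolding D by (simp add: max_def)
  then have "r \<le> 2 powr \<xi> * (2 * exp D)"
    using up unfolding ex by (meson mult_left_mono order_trans powr_ge_zero)
  also have "2 powr \<xi> * (2 * exp D) = exp (D + (\<xi> + 1) * ln 2)"
    by (simp add: powr_def exp_add algebra_simps)
  finally have "ln r \<le> D + (\<xi> + 1) * ln 2"
    using \<open>0 < r\<close> by (metis ln_exp ln_mono)
  then show ?thesis using r(1) \<open>0 < r\<close> lower that by blast
qed

lemma limit_interior_finite:
  assumes "0 < s" "0 < t" and \<xi>: "0 \<le> \<xi>" "\<xi> < \<theta>" "\<xi> < \<mu> - \<theta>"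
  shows "(\<lambda>N. ln_ennreal (moment_Z \<xi> (nat \<lfloor>real N * s\<rfloor>) (nat \<lfloor>real N * t\<rfloor>)) / ereal (real N)) \<longlonglongrightarrow>
    ereal (max (s * ln (gamma_moment \<theta> \<xi>) - t * ln (gamma_moment (\<mu> - \<theta>) (- \<xi>)))
      (t * ln (gamma_moment (\<mu> - \<theta>) \<xi>) - s * ln (gamma_moment \<theta> (- \<xi>))))"
proof -
  let ?m = "\<lambda>N. nat \<lfloor>real N * s\<rfloor>" and ?n = "\<lambda>N. nat \<lfloor>real N * t\<rfloor>"
  define a where "a = ln (gamma_moment \<theta> \<xi>)"
  define a' where "a' = ln (gamma_moment \<theta> (- \<xi>))"
  define b where "b = ln (gamma_moment (\<mu> - \<theta>) \<xi>)"
  define b' where "b' = ln (gamma_moment (\<mu> - \<theta>) (- \<xi>))"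
  define D where "D N = max (real (?m N) * a - real (?n N) * b') (real (?n N) * b - real (?m N) * a')" for N
  define L where "L N = ln_ennreal (moment_Z \<xi> (?m N) (?n N)) / ereal (real N)" for N
  have Dlim: "(\<lambda>N. D N / real N) \<longlonglongrightarrow> max (s * a - t * b') (t * b - s * a')"
  proof -
    have "(\<lambda>N. max (real (?m N) / real N * a - real (?n N) / real N * b')
        (real (?n N) / real N * b - real (?m N) / real N * a')) \<longlonglongrightarrow> max (s * a - t * b') (t * b - s * a')"
      using assms by (intro tendsto_intros tendsto_nat_floor_div) auto
    moreover have "max (real (?m N) / real N * a - real (?n N) / real N * b')
        (real (?n N) / real N * b - real (?m N) / real N * a') = D N / real N" for N
      unfolding D_def by (auto simp: max_def divide_simps)
    ultimately show ?thesis by simp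
  qed
  \<comment> \<open>Beyond \<open>1 / s\<close> the first coordinate is at least 1, so the endpoint
    is not the origin.\<close>
  have ev: "\<forall>\<^sub>F N in sequentially. N > 0 \<and> 1 / s < real N"
    using eventually_conj[OF eventually_gt_at_top[of 0] filterlim_at_top_dense[THEN iffD1, OF filterlim_real_sequentially, rule_format, of "1 / s"]] .
  have bnd: "\<forall>\<^sub>F N in sequentially.
      ereal (D N / real N - (\<xi> + 1) * (ln (real (Suc (?m N + ?n N))) / real N)) \<le> L N \<and>
      L N \<le> ereal (D N / real N + (\<xi> + 1) * ln 2 * (1 / real N))"
    using ev
  proof eventually_elim
    case (elim N)
    have "1 < real N * s" using elim assms by (simp add: field_simps)
    then have "?m N \<noteq> 0" by linarith
    then have "(?m N, ?n N) \<noteq> (0, 0)" by simp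
    from ln_moment_Z_bounds[OF \<xi> this] obtain r where r: "moment_Z \<xi> (?m N) (?n N) = ennreal r" "0 < r"
      "D N - (\<xi> + 1) * ln (real (Suc (?m N + ?n N))) \<le> ln r" "ln r \<le> D N + (\<xi> + 1) * ln 2"
      unfolding D_def a_def a'_def b_def b'_def by metis
    have L: "L N = ereal (ln r / real N)"
      using elim r(1,2) by (simp add: L_def ln_ennreal_ennreal)
    have "(D N - (\<xi> + 1) * ln (real (Suc (?m N + ?n N)))) / real N \<le> ln r / real N"
      "ln r / real N \<le> (D N + (\<xi> + 1) * ln 2) / real N"
      using r(3,4) by (auto intro!: divide_right_mono simp del: of_nat_Suc)
    then show ?case
      unfolding L by (simp add: diff_divide_distrib add_divide_distrib)
  qed
  have "L \<longlonglongrightarrow> ereal (max (s * a - t * b') (t * b - s * a'))"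
  proof (rule tendsto_sandwich)
    show "\<forall>\<^sub>F N in sequentially. ereal (D N / real N - (\<xi> + 1) * (ln (real (Suc (?m N + ?n N))) / real N)) \<le> L N"
      "\<forall>\<^sub>F N in sequentially. L N \<le> ereal (D N / real N + (\<xi> + 1) * ln 2 * (1 / real N))"
      using bnd by (auto elim: eventually_mono)
    have "(\<lambda>N. D N / real N - (\<xi> + 1) * (ln (real (Suc (?m N + ?n N))) / real N))
        \<longlonglongrightarrow> max (s * a - t * b') (t * b - s * a') - (\<xi> + 1) * 0"
      using assms by (intro tendsto_intros Dlim tendsto_ln_floor_div) auto
    then show "(\<lambda>N. ereal (D N / real N - (\<xi> + 1) * (ln (real (Suc (?m N + ?n N))) / real N)))
        \<longlonglongrightarrow> ereal (max (s * a - t * b') (t * b - s * a'))"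
      by (simp only: lim_ereal mult_zero_right diff_zero)
    have "(\<lambda>N. D N / real N + (\<xi> + 1) * ln 2 * (1 / real N))
        \<longlonglongrightarrow> max (s * a - t * b') (t * b - s * a') + (\<xi> + 1) * ln 2 * 0"
      by (intro tendsto_intros Dlim lim_1_over_n)
    then show "(\<lambda>N. ereal (D N / real N + (\<xi> + 1) * ln 2 * (1 / real N)))
        \<longlonglongrightarrow> ereal (max (s * a - t * b') (t * b - s * a'))"
      by (simp only: lim_ereal mult_zero_right add_0_right)
  qed
  then show ?thesis unfolding L_def[abs_def] a_def a'_def b_def b'_def .
qed

text \<open>From some index on both coordinates are positive, and then the moment itself is
  infinite.\<close>

lemma limit_interior_infinite:
  assumes "0 < s" "0 < t" "min \<theta> (\<mu> - \<theta>) \<le> \<xi>"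
  shows "(\<lambda>N. ln_ennreal (moment_Z \<xi> (nat \<lfloor>real N * s\<rfloor>) (nat \<lfloor>real N * t\<rfloor>)) / ereal (real N)) \<longlonglongrightarrow> \<infinity>"
proof (rule tendsto_eventually)
  have "\<forall>\<^sub>F N in sequentially. max (1 / s) (1 / t) < real N"
    using filterlim_at_top_dense[THEN iffD1, OF filterlim_real_sequentially] by blast
  then show "\<forall>\<^sub>F N in sequentially.
      ln_ennreal (moment_Z \<xi> (nat \<lfloor>real N * s\<rfloor>) (nat \<lfloor>real N * t\<rfloor>)) / ereal (real N) = \<infinity>"
  proof eventually_elim
    case (elim N)
    then have "1 < real N * s" "1 < real N * t" using assms by (auto simp: field_simps)
    then have "0 < nat \<lfloor>real N * s\<rfloor>" "0 < nat \<lfloor>real N * t\<rfloor>" by linarith+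
    then show ?case
      using moment_Z_infinite[OF assms(3)] by (simp add: ln_ennreal_def)
  qed
qed

text \<open>On the axis the partition function is a product of independent weights. The limit is
  written as a maximum to agree with the theorem at \<open>s = 0\<close>.\<close>

lemma limit_axis:
  assumes "0 \<le> t" "0 \<le> \<xi>"
  shows "(\<lambda>N. ln_ennreal (moment_Z \<xi> 0 (nat \<lfloor>real N * t\<rfloor>)) / ereal (real N)) \<longlonglongrightarrow>
    max (- (ereal t * M_fun (\<mu> - \<theta>) (- \<xi>))) (ereal t * M_fun (\<mu> - \<theta>) \<xi>)"
proof (cases "\<xi> < \<mu> - \<theta>")
  case True
  define v where "v = gamma_moment (\<mu> - \<theta>) \<xi>"
  define v' where "v' = gamma_moment (\<mu> - \<theta>) (- \<xi>)"
  have v: "0 < v" "0 < v'" "1 \<le> v * v'"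
    using True assms(2) by (auto simp: v_def v'_def intro!: gamma_moment_pos gamma_moment_mult_ge_1)
  \<comment> \<open>This makes the second entry of the maximum the larger one.\<close>
  have "0 \<le> ln (v * v')" using v by simp
  then have "0 \<le> ln v + ln v'" using v by (simp add: ln_mult_pos)
  then have "- (t * ln v') \<le> t * ln v"
    using mult_left_mono[of 0 "ln v + ln v'" t] assms(1) by (simp add: distrib_left)
  then have rhs: "max (- (ereal t * M_fun (\<mu> - \<theta>) (- \<xi>))) (ereal t * M_fun (\<mu> - \<theta>) \<xi>) = ereal (t * ln v)"
    using True assms(2) theta_less by (simp add: M_fun_eq v_def v'_def max_def)
  have "(\<lambda>N. real (nat \<lfloor>real N * t\<rfloor>) / real N * ln v) \<longlonglongrightarrow> t * ln v"
    by (intro tendsto_intros tendsto_nat_floor_div assms)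
  then have "(\<lambda>N. ereal (real (nat \<lfloor>real N * t\<rfloor>) / real N * ln v)) \<longlonglongrightarrow> ereal (t * ln v)"
    by simp
  moreover have "\<forall>\<^sub>F N in sequentially. ereal (real (nat \<lfloor>real N * t\<rfloor>) / real N * ln v)
      = ln_ennreal (moment_Z \<xi> 0 (nat \<lfloor>real N * t\<rfloor>)) / ereal (real N)"
    using eventually_gt_at_top[of 0]
  proof eventually_elim
    case (elim N)
    have "moment_Z \<xi> 0 (nat \<lfloor>real N * t\<rfloor>) = ennreal (v ^ nat \<lfloor>real N * t\<rfloor>)"
      using True v by (simp add: moment_Z_axis v_def ennreal_power)
    then show ?case
      using elim v by (simp add: ln_ennreal_ennreal ln_realpow)
  qed
  ultimately show ?thesis unfolding rhs by (rule Lim_transform_eventually)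
next
  case inf: False
  show ?thesis
  proof (cases "t = 0")
    case True
    \<comment> \<open>All moments are empty products here, and the convention
      \<open>0 * \<infinity> = 0\<close> makes the right side 0 as well.\<close>
    then show ?thesis
      using ln_ennreal_ennreal[of 1] by (auto simp: moment_Z_axis zero_ereal_def[symmetric])
  next
    case False
    have "max (- (ereal t * M_fun (\<mu> - \<theta>) (- \<xi>))) (ereal t * M_fun (\<mu> - \<theta>) \<xi>) = \<infinity>"
      using inf False assms by (simp add: M_fun_def)
    moreover have "(\<lambda>N. ln_ennreal (moment_Z \<xi> 0 (nat \<lfloor>real N * t\<rfloor>)) / ereal (real N)) \<longlonglongrightarrow> \<infinity>"
    proof (rule tendsto_eventually)
      have "\<forall>\<^sub>F N in sequentially. 1 / t < real N"
        using filterlim_at_top_dense[THEN iffD1, OF filterlim_real_sequentially] by blast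
      then show "\<forall>\<^sub>F N in sequentially. ln_ennreal (moment_Z \<xi> 0 (nat \<lfloor>real N * t\<rfloor>)) / ereal (real N) = \<infinity>"
      proof eventually_elim
        case (elim N)
        then have "1 < real N * t" using assms False by (simp add: field_simps)
        then have "0 < nat \<lfloor>real N * t\<rfloor>" by linarith
        then show ?case
          using moment_Z_infinite_vertical[of \<xi>] inf by (simp add: ln_ennreal_def)
      qed
    qed
    ultimately show ?thesis by simp
  qed
qed

end

theorem theorem2p11:
  fixes M :: "'a measure"
    and \<mu> \<theta> s t \<xi> :: real
    and U V :: "nat \<Rightarrow> 'a \<Rightarrow> real"
    and Y :: "nat \<times> nat \<Rightarrow> 'a \<Rightarrow> real"
  assumes "stationary_log_gamma M \<mu> \<theta> U V Y"
    and "0 \<le> s" and "0 \<le> t" and "0 \<le> \<xi>"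
  shows "(\<lambda>n. ln_ennreal (\<integral>\<^sup>+ \<omega>. ennreal (exp (\<xi> * ln
              (Z_stat U V Y (nat \<lfloor>real n * s\<rfloor>) (nat \<lfloor>real n * t\<rfloor>) \<omega>))) \<partial>M) / ereal (real n))
    \<longlonglongrightarrow>
      (if \<xi> < min \<theta> (\<mu> - \<theta>) \<or> s = 0 \<or> t = 0
       then max (ereal s * M_fun \<theta> \<xi> - ereal t * M_fun (\<mu> - \<theta>) (- \<xi>))
                (ereal t * M_fun (\<mu> - \<theta>) \<xi> - ereal s * M_fun \<theta> (- \<xi>))
       else \<infinity>)"
proof -
  interpret stationary_log_gamma M \<mu> \<theta> U V Y by fact
  interpret sw: stationary_log_gamma M \<mu> "\<mu> - \<theta>" V U "\<lambda>p. Y (prod.swap p)"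
    by (rule swap_model)
  \<comment> \<open>In an axis direction only one family of boundary weights enters, so the
    threshold of the other family has no effect and the direction is treated separately.\<close>
  consider "s = 0" | "t = 0" | "0 < s" "0 < t" "\<xi> < min \<theta> (\<mu> - \<theta>)" | "0 < s" "0 < t" "min \<theta> (\<mu> - \<theta>) \<le> \<xi>"
    using assms(2,3) by argo
  then show ?thesis
  proof cases
    case 1
    then show ?thesis unfolding moment_Z_eq
      using limit_axis[OF assms(3,4)] by (simp add: zero_ereal_def[symmetric])
  next
    \<comment> \<open>The horizontal axis is the vertical axis of the reflected model.\<close>
    case 2
    then show ?thesis unfolding moment_Z_eq
      using sw.limit_axis[OF assms(2,4)] by (simp add: moment_Z_swap max.commute zero_ereal_def[symmetric])
  next
    case 3
    then show ?thesis
      unfolding moment_Z_eq using limit_interior_finite[OF 3(1,2) assms(4)] assms(4) theta_pos theta_less by (simp add: M_fun_eq)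
  next
    case 4
    then show ?thesis
      unfolding moment_Z_eq using limit_interior_infinite[OF 4] by (subst if_not_P) auto
  qed
qed

end
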